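(* Let $F:L^2(\Omega,\mathbb{P};\mathbb{R}^d)\to\mathbb{R}$ be law invariant and let $X\in L^2(\Omega,\mathbb{P};\mathbb{R}^d)$ have law $\mu$. If $F$ is Fréchet differentiable at $X$, then there exists a measurable function $g\in L^2(\mathbb{R}^d,\mu;\mathbb{R}^d)$ such that the Fréchet derivative of $F$ at $X$ is equal to $g(X)$, and $F$ is Fréchet differentiable with Fréchet derivative $g(\tilde X)$ at each $\tilde X\in L^2(\Omega,\mathbb{P};\mathbb{R}^d)$ with law $\mu$.
   Context: $(\Omega,\mathcal{A},\mathbb{P})$ is an atomless probability space (equivalently, it supports a random variable uniformly distributed on $[0,1]$), and $L^2(\Omega,\mathbb{P};\mathbb{R}^d)$ is the space of $\mathbb{R}^d$-valued square integrable random variables on it. $F$ is law invariant if $F(X)=F(X')$ whenever $X$ and $X'$ have the same law. When $F$ is Fréchet differentiable at $X$, its Fréchet derivative $DF(X)$ is the element of $L^2(\Omega,\mathbb{P};\mathbb{R}^d)$ representing the differential by the Riesz theorem: $F(X+H)=F(X)+\mathbb{E}[DF(X)\cdot H]+o(\|H\|_2)$ as $\|H\|_2=\mathbb{E}^{1/2}[|H|^2]\to0$. *)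

theory Defs
  imports "HOL-Probability.Probability"
begin

definition atomless :: "'w measure \<Rightarrow> bool" where
  "atomless M \<longleftrightarrow>
     (\<forall>A\<in>sets M. 0 < emeasure M A \<longrightarrow>
        (\<exists>B\<in>sets M. B \<subseteq> A \<and> 0 < emeasure M B \<and> emeasure M B < emeasure M A))"

text \<open>Square integrable random variables are represented by functions rather than by almost
  everywhere classes. A law invariant functional takes the same value on almost everywhere equal
  elements, so it is a functional on classes; its values at functions that are not square
  integrable play no role.\<close>

definition sq_integrable :: "'w measure \<Rightarrow> ('w \<Rightarrow> 'b::euclidean_space) set" where
  "sq_integrable M = {Y \<in> borel_measurable M. integrable M (\<lambda>w. (norm (Y w))\<^sup>2)}"

definition sq_norm :: "'w measure \<Rightarrow> ('w \<Rightarrow> 'b::euclidean_space) \<Rightarrow> real" where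
  "sq_norm M Y = sqrt (\<integral>w. (norm (Y w))\<^sup>2 \<partial>M)"

definition law_invariant :: "'w measure \<Rightarrow> (('w \<Rightarrow> 'b::euclidean_space) \<Rightarrow> real) \<Rightarrow> bool" where
  "law_invariant M F \<longleftrightarrow>
     (\<forall>Y\<in>sq_integrable M. \<forall>Z\<in>sq_integrable M.
        distr M borel Y = distr M borel Z \<longrightarrow> F Y = F Z)"

definition bounded_linear_functional ::
    "'w measure \<Rightarrow> (('w \<Rightarrow> 'b::euclidean_space) \<Rightarrow> real) \<Rightarrow> bool" where
  "bounded_linear_functional M L \<longleftrightarrow>
     (\<forall>H\<in>sq_integrable M. \<forall>K\<in>sq_integrable M. L (\<lambda>w. H w + K w) = L H + L K) \<and>
     (\<forall>c. \<forall>H\<in>sq_integrable M. L (\<lambda>w. c *\<^sub>R H w) = c * L H) \<and>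
     (\<exists>C. \<forall>H\<in>sq_integrable M. \<bar>L H\<bar> \<le> C * sq_norm M H)"

definition has_frechet_differential ::
    "'w measure \<Rightarrow> (('w \<Rightarrow> 'b::euclidean_space) \<Rightarrow> real) \<Rightarrow> ('w \<Rightarrow> 'b) \<Rightarrow>
       (('w \<Rightarrow> 'b) \<Rightarrow> real) \<Rightarrow> bool" where
  "has_frechet_differential M F X L \<longleftrightarrow>
     bounded_linear_functional M L \<and>
     (\<forall>\<epsilon>>0. \<exists>\<delta>>0. \<forall>H\<in>sq_integrable M. sq_norm M H < \<delta> \<longrightarrow>
        \<bar>F (\<lambda>w. X w + H w) - F X - L H\<bar> \<le> \<epsilon> * sq_norm M H)"

definition frechet_differentiable_at ::
    "'w measure \<Rightarrow> (('w \<Rightarrow> 'b::euclidean_space) \<Rightarrow> real) \<Rightarrow> ('w \<Rightarrow> 'b) \<Rightarrow> bool" where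
  "frechet_differentiable_at M F X \<longleftrightarrow> (\<exists>L. has_frechet_differential M F X L)"

text \<open>\<open>D\<close> is the Riesz representative of the differential of \<open>F\<close> at \<open>X\<close>; it is determined only
  up to almost everywhere equality.\<close>

definition has_frechet_derivative_at ::
    "'w measure \<Rightarrow> (('w \<Rightarrow> 'b::euclidean_space) \<Rightarrow> real) \<Rightarrow> ('w \<Rightarrow> 'b) \<Rightarrow> ('w \<Rightarrow> 'b) \<Rightarrow> bool" where
  "has_frechet_derivative_at M F X D \<longleftrightarrow>
     D \<in> sq_integrable M \<and>
     has_frechet_differential M F X (\<lambda>H. \<integral>w. D w \<bullet> H w \<partial>M)"

end

theory Submission
  imports Defs
begin

text \<open>Let \<open>D\<close> be the Riesz representative of the differential at \<open>X\<close>. An atomless space carries a copy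
  of any random variable with a prescribed joint law with a given countable label. Copies made
  jointly with a label of \<open>X\<close> that takes the same value only at nearby points are
  perturbations of \<open>X\<close> controlled in \<open>L\<^sup>2\<close>, and law invariance compares the values of \<open>F\<close> there exactly.
  Comparing \<open>X + t D\<close> with a copy whose perturbation \<open>\<approx> t D'\<close> is conditionally independent of \<open>D\<close> given
  the label, one gets \<open>E[D \<bullet> D'] \<approx> E[\<bar>D\<bar>\<^sup>2]\<close>, so \<open>D \<approx> D'\<close> and \<open>D\<close> is a limit of functions of \<open>X\<close>. For \<open>X'\<close> with
  the law of \<open>X\<close>, a copy of \<open>X' + H\<close> near \<open>X\<close> transports the first order expansion from \<open>X\<close> to \<open>X'\<close>.\<close>

section \<open>Square integrable random variables\<close>

text \<open>The obstacle is that an atomless space need not carry randomness independent of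
  \<open>X\<close>: \<open>X\<close> may generate the whole sigma-algebra, and then an exact copy
  jointly with \<open>X\<close> can fail to exist. A countable label always leaves room, because
  each of its cells of positive measure is again atomless. This is why all comparisons go through
  quantizations and all identities hold only up to an error. The error must be small relative to the
  step \<open>t\<close>, so the cells of \<open>X\<close> are chosen after \<open>t\<close> and much
  smaller, whereas the cells of \<open>D\<close> only have to be small. A copy of \<open>D\<close>
  has nearly the norm of \<open>D\<close>, so a nearly maximal inner product with \<open>D\<close>
  is near equality in Cauchy-Schwarz and forces closeness. Conditional independence is what turns a
  random copy into a function: within a cell of the label, the mean squared distance to the copy is
  an average over its values, so one constant value does at least as well.\<close>

lemma sq_integrableD:
  assumes "Y \<in> sq_integrable M"
  shows "Y \<in> borel_measurable M" "integrable M (\<lambda>w. (norm (Y w))\<^sup>2)"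
  using assms by (auto simp: sq_integrable_def)

lemma sq_norm_nonneg [simp]: "0 \<le> sq_norm M Y"
  by (simp add: sq_norm_def)

lemma sq_norm_power2: "(sq_norm M Y)\<^sup>2 = (\<integral>w. (norm (Y w))\<^sup>2 \<partial>M)"
  by (simp add: sq_norm_def)

lemma integrable_inner_sq_integrable:
  assumes "Y \<in> sq_integrable M" "Z \<in> sq_integrable M"
  shows "integrable M (\<lambda>w. Y w \<bullet> Z w)"
proof (rule Bochner_Integration.integrable_bound)
  show "integrable M (\<lambda>w. (norm (Y w))\<^sup>2 + (norm (Z w))\<^sup>2)"
    using assms by (auto simp: sq_integrable_def)
  show "(\<lambda>w. Y w \<bullet> Z w) \<in> borel_measurable M"
    using assms by (auto simp: sq_integrable_def)
  have "\<bar>y \<bullet> z\<bar> \<le> (norm y)\<^sup>2 + (norm z)\<^sup>2" for y z :: 'b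
  proof -
    have "\<bar>y \<bullet> z\<bar> \<le> norm y * norm z" by (rule Cauchy_Schwarz_ineq2)
    also have "\<dots> \<le> (norm y)\<^sup>2 + (norm z)\<^sup>2"
      using sum_squares_bound[of "norm y" "norm z"] mult_nonneg_nonneg[OF norm_ge_zero[of y] norm_ge_zero[of z]]
      by linarith
    finally show ?thesis .
  qed
  then show "AE w in M. norm (Y w \<bullet> Z w) \<le> norm ((norm (Y w))\<^sup>2 + (norm (Z w))\<^sup>2)"
    by simp
qed

lemma sq_integrable_add:
  assumes "Y \<in> sq_integrable M" "Z \<in> sq_integrable M"
  shows "(\<lambda>w. Y w + Z w) \<in> sq_integrable M"
proof -
  have "integrable M (\<lambda>w. (norm (Y w))\<^sup>2 + 2 * (Y w \<bullet> Z w) + (norm (Z w))\<^sup>2)"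
    using assms integrable_inner_sq_integrable[OF assms] by (auto simp: sq_integrable_def)
  moreover have "(norm (y + z))\<^sup>2 = (norm y)\<^sup>2 + 2 * (y \<bullet> z) + (norm z)\<^sup>2" for y z :: 'b
    by (simp add: power2_norm_eq_inner inner_add inner_commute)
  ultimately show ?thesis using assms by (auto simp: sq_integrable_def)
qed

lemma sq_integrable_scaleR:
  assumes "Y \<in> sq_integrable M"
  shows "(\<lambda>w. c *\<^sub>R Y w) \<in> sq_integrable M"
  using assms by (auto simp: sq_integrable_def power_mult_distrib)

lemma sq_integrable_diff:
  assumes "Y \<in> sq_integrable M" "Z \<in> sq_integrable M"
  shows "(\<lambda>w. Y w - Z w) \<in> sq_integrable M"
  using sq_integrable_add[OF assms(1) sq_integrable_scaleR[OF assms(2), of "-1"]] by simp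

lemma sq_norm_scaleR: "sq_norm M (\<lambda>w. c *\<^sub>R Y w) = \<bar>c\<bar> * sq_norm M Y"
  by (simp add: sq_norm_def power_mult_distrib real_sqrt_mult)

lemma sq_norm_add_power2:
  assumes "Y \<in> sq_integrable M" "Z \<in> sq_integrable M"
  shows "(sq_norm M (\<lambda>w. Y w + Z w))\<^sup>2 =
    (sq_norm M Y)\<^sup>2 + 2 * (\<integral>w. Y w \<bullet> Z w \<partial>M) + (sq_norm M Z)\<^sup>2"
proof -
  have "(norm (y + z))\<^sup>2 = (norm y)\<^sup>2 + 2 * (y \<bullet> z) + (norm z)\<^sup>2" for y z :: 'b
    by (simp add: power2_norm_eq_inner inner_add inner_commute)
  then show ?thesis
    using assms integrable_inner_sq_integrable[OF assms]
    by (simp add: sq_norm_power2 sq_integrable_def)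
qed

lemma sq_norm_diff_power2:
  assumes "Y \<in> sq_integrable M" "Z \<in> sq_integrable M"
  shows "(sq_norm M (\<lambda>w. Y w - Z w))\<^sup>2 =
    (sq_norm M Y)\<^sup>2 - 2 * (\<integral>w. Y w \<bullet> Z w \<partial>M) + (sq_norm M Z)\<^sup>2"
  using sq_norm_add_power2[OF assms(1) sq_integrable_scaleR[OF assms(2), of "-1"]]
    sq_norm_scaleR[of M "-1" Z]
  by simp

text \<open>For small \<open>s\<close> of the opposite sign a linear term would dominate the
  quadratic one. This gives the Euler equation of the minimiser in the Riesz argument.\<close>

lemma quadratic_nonneg_imp_zero:
  fixes b c :: real
  assumes "\<And>s. 0 \<le> 2 * s * b + s\<^sup>2 * c"
  shows "b = 0"
proof (rule ccontr)
  assume "b \<noteq> 0"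
  \<comment> \<open>\<open>k\<close> is positive and exceeds \<open>c\<close> whatever the sign of
    \<open>c\<close>, so at \<open>s = - b / k\<close> the linear term outweighs the quadratic
    one.\<close>
  define k where "k = \<bar>c\<bar> + 1"
  have k: "k > 0" "c < k" unfolding k_def by auto
  have "0 \<le> 2 * (- b / k) * b + (- b / k)\<^sup>2 * c" by (rule assms)
  also have "\<dots> = (b\<^sup>2 / k) * (c / k - 2)"
    using k by (simp add: field_simps power2_eq_square)
  also have "\<dots> < 0"
    using k \<open>b \<noteq> 0\<close> by (intro mult_pos_neg) (auto simp: field_simps)
  finally show False by simp
qed

lemma sq_norm_cauchy_schwarz:
  assumes "Y \<in> sq_integrable M" "Z \<in> sq_integrable M"
  shows "\<bar>\<integral>w. Y w \<bullet> Z w \<partial>M\<bar> \<le> sq_norm M Y * sq_norm M Z"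
proof -
  define A B C where "A = (sq_norm M Y)\<^sup>2" "B = (\<integral>w. Y w \<bullet> Z w \<partial>M)" "C = (sq_norm M Z)\<^sup>2"
  have q: "0 \<le> A + 2 * s * B + s\<^sup>2 * C" for s
  proof -
    have "0 \<le> (sq_norm M (\<lambda>w. Y w + s *\<^sub>R Z w))\<^sup>2" by simp
    also have "\<dots> = A + 2 * s * B + s\<^sup>2 * C"
      unfolding A_B_C_def sq_norm_add_power2[OF assms(1) sq_integrable_scaleR[OF assms(2)]]
        sq_norm_scaleR by (simp add: power_mult_distrib)
    finally show ?thesis .
  qed
  have "B\<^sup>2 \<le> A * C"
  proof (cases "C = 0")
    case True
    have "B = 0"
    proof (rule ccontr)
      assume "B \<noteq> 0"
      \<comment> \<open>With \<open>C = 0\<close> the quadratic is affine in \<open>s\<close>; at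
        this \<open>s\<close> its value is -1.\<close>
      then show False using q[of "- (A + 1) / (2 * B)"] True by (simp add: field_simps)
    qed
    then show ?thesis using True by simp
  next
    case False
    then have "C > 0" by (simp add: A_B_C_def)
    \<comment> \<open>The minimiser of the quadratic, where its value is
      \<open>A - B\<^sup>2 / C\<close>.\<close>
    then show ?thesis using q[of "- B / C"] by (simp add: field_simps power2_eq_square)
  qed
  then have "\<bar>B\<bar> \<le> sqrt (A * C)" using real_le_rsqrt by simp
  then show ?thesis by (simp add: A_B_C_def real_sqrt_mult)
qed

lemma sq_norm_triangle:
  assumes "Y \<in> sq_integrable M" "Z \<in> sq_integrable M"
  shows "sq_norm M (\<lambda>w. Y w + Z w) \<le> sq_norm M Y + sq_norm M Z"
proof (rule power2_le_imp_le)
  show "(sq_norm M (\<lambda>w. Y w + Z w))\<^sup>2 \<le> (sq_norm M Y + sq_norm M Z)\<^sup>2"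
    using sq_norm_cauchy_schwarz[OF assms]
    by (simp add: sq_norm_add_power2[OF assms] power2_sum)
qed simp

lemma sq_norm_minus_commute: "sq_norm M (\<lambda>w. Y w - Z w) = sq_norm M (\<lambda>w. Z w - Y w)"
  by (simp add: sq_norm_def norm_minus_commute)

lemma sq_norm_le_add_diff:
  assumes "Y \<in> sq_integrable M" "Z \<in> sq_integrable M"
  shows "sq_norm M Y \<le> sq_norm M Z + sq_norm M (\<lambda>w. Y w - Z w)"
  using sq_norm_triangle[OF assms(2) sq_integrable_diff[OF assms]] by simp

lemma (in prob_space) sq_norm_le_const:
  assumes "Y \<in> borel_measurable M" "AE w in M. norm (Y w) \<le> c"
  shows "Y \<in> sq_integrable M" "sq_norm M Y \<le> c"
proof -
  have "AE w in M. 0 \<le> c"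
    using assms(2) by eventually_elim (rule order_trans[OF norm_ge_zero])
  then have c: "0 \<le> c" by simp
  have le: "AE w in M. (norm (Y w))\<^sup>2 \<le> c\<^sup>2"
    using assms(2) by eventually_elim (simp add: power_mono)
  have int: "integrable M (\<lambda>w. (norm (Y w))\<^sup>2)"
    using assms(1) le by (intro integrable_const_bound[where B="c\<^sup>2"]) auto
  then show "Y \<in> sq_integrable M" using assms(1) by (simp add: sq_integrable_def)
  have "(\<integral>w. (norm (Y w))\<^sup>2 \<partial>M) \<le> (\<integral>w. c\<^sup>2 \<partial>M)"
    using int le by (intro integral_mono_AE) auto
  then have "(sq_norm M Y)\<^sup>2 \<le> c\<^sup>2" by (simp add: sq_norm_power2 prob_space)
  then show "sq_norm M Y \<le> c" using c by (rule power2_le_imp_le)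
qed

lemma sq_integrable_iff_nn_integral:
  "Y \<in> sq_integrable M \<longleftrightarrow>
    Y \<in> borel_measurable M \<and> (\<integral>\<^sup>+w. ennreal ((norm (Y w))\<^sup>2) \<partial>M) < \<infinity>"
  by (auto simp: sq_integrable_def integrable_iff_bounded)

lemma nn_integral_sq_norm:
  assumes "Y \<in> sq_integrable M"
  shows "(\<integral>\<^sup>+w. ennreal ((norm (Y w))\<^sup>2) \<partial>M) = ennreal ((sq_norm M Y)\<^sup>2)"
  unfolding sq_norm_power2
  using assms by (intro nn_integral_eq_integral) (auto simp: sq_integrable_def)

lemma sq_norm_leI:
  assumes "Y \<in> borel_measurable M" "(\<integral>\<^sup>+w. ennreal ((norm (Y w))\<^sup>2) \<partial>M) \<le> ennreal (c\<^sup>2)" "0 \<le> c"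
  shows "Y \<in> sq_integrable M" "sq_norm M Y \<le> c"
proof -
  show *: "Y \<in> sq_integrable M"
    using assms by (auto simp: sq_integrable_iff_nn_integral less_top[symmetric] top_unique)
  have "(sq_norm M Y)\<^sup>2 \<le> c\<^sup>2"
    using assms(2) unfolding nn_integral_sq_norm[OF *] by simp
  then show "sq_norm M Y \<le> c" using assms(3) by (rule power2_le_imp_le)
qed

lemma sq_norm_eq_0_iff:
  assumes "Y \<in> sq_integrable M"
  shows "sq_norm M Y = 0 \<longleftrightarrow> (AE w in M. Y w = 0)"
  using assms unfolding sq_norm_def
  by (subst real_sqrt_eq_0_iff, subst integral_nonneg_eq_0_iff_AE) (auto simp: sq_integrable_def)

section \<open>Completeness of L^2 and the Riesz representation\<close>

lemma (in prob_space) nn_integral_norm_le_sq_norm: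
  assumes "Y \<in> sq_integrable M"
  shows "(\<integral>\<^sup>+w. ennreal (norm (Y w)) \<partial>M) \<le> ennreal (sq_norm M Y)"
proof -
  have m: "Y \<in> borel_measurable M" using assms by (rule sq_integrableD)
  \<comment> \<open>Cauchy-Schwarz against the constant 1, which has norm 1 on a probability
    space.\<close>
  have "(\<integral>\<^sup>+w. ennreal (norm (Y w)) * 1 \<partial>M)\<^sup>2 \<le>
      (\<integral>\<^sup>+w. (ennreal (norm (Y w)))\<^sup>2 \<partial>M) * (\<integral>\<^sup>+w. 1\<^sup>2 \<partial>M)"
    using m by (intro Cauchy_Schwarz_nn_integral) auto
  also have "\<dots> = (ennreal (sq_norm M Y))\<^sup>2"
    using nn_integral_sq_norm[OF assms] by (simp add: ennreal_power emeasure_space_1)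
  finally have "(\<integral>\<^sup>+w. ennreal (norm (Y w)) \<partial>M)\<^sup>2 \<le> (ennreal (sq_norm M Y))\<^sup>2" by simp
  then show ?thesis
    by (cases "\<integral>\<^sup>+w. ennreal (norm (Y w)) \<partial>M")
      (auto simp: ennreal_power power_mono_iff top_unique top_power_ennreal)
qed

text \<open>Riesz-Fischer argument. The geometric rate makes the L^1 norms of the increments
  summable, so the sequence itself converges almost everywhere; Fatou's lemma then carries the same
  rate over to the limit.\<close>

lemma (in prob_space) sq_integrable_complete:
  fixes H :: "nat \<Rightarrow> 'a \<Rightarrow> 'b::euclidean_space"
  assumes H: "\<And>n. H n \<in> sq_integrable M"
    and cauchy: "\<And>n k. n \<le> k \<Longrightarrow> sq_norm M (\<lambda>w. H k w - H n w) \<le> c * (1/2)^n"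
  shows "\<exists>D\<in>sq_integrable M. \<forall>n. sq_norm M (\<lambda>w. D w - H n w) \<le> c * (1/2)^n"
proof -
  have c: "0 \<le> c" using order_trans[OF sq_norm_nonneg cauchy[of 0 0]] by simp
  have m[measurable]: "H n \<in> borel_measurable M" for n using H by (rule sq_integrableD)
  define D where "D w = lim (\<lambda>n. H n w)" for w
  have [measurable]: "D \<in> borel_measurable M"
    unfolding D_def by (rule borel_measurable_lim_metric) (rule m)
  have "(\<integral>\<^sup>+w. (\<Sum>n. ennreal (norm (H (Suc n) w - H n w))) \<partial>M) =
      (\<Sum>n. \<integral>\<^sup>+w. ennreal (norm (H (Suc n) w - H n w)) \<partial>M)"
    by (rule nn_integral_suminf) measurable
  also have "\<dots> \<le> (\<Sum>n. ennreal (c * (1/2)^n))"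
  proof (rule suminf_le)
    fix n
    show "(\<integral>\<^sup>+w. ennreal (norm (H (Suc n) w - H n w)) \<partial>M) \<le> ennreal (c * (1/2)^n)"
      using nn_integral_norm_le_sq_norm[OF sq_integrable_diff[OF H[of "Suc n"] H[of n]]]
        cauchy[of n "Suc n"]
      by (meson ennreal_leI le_SucI order_refl order_trans)
  qed auto
  also have "\<dots> = ennreal (\<Sum>n. c * (1/2)^n)"
    using c by (intro suminf_ennreal2 summable_mult summable_geometric) auto
  also have "\<dots> < \<infinity>" by simp
  finally have "AE w in M. (\<Sum>n. ennreal (norm (H (Suc n) w - H n w))) \<noteq> \<infinity>"
    by (intro nn_integral_PInf_AE) auto
  then have lim: "AE w in M. (\<lambda>n. H n w) \<longlonglongrightarrow> D w"
  proof eventually_elim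
    case (elim w)
    then have "summable (\<lambda>n. norm (H (Suc n) w - H n w))"
      by (intro summable_suminf_not_top) auto
    then have "summable (\<lambda>n. H (Suc n) w - H n w)" by (rule summable_norm_cancel)
    then have "convergent (\<lambda>n. \<Sum>i<n. H (Suc i) w - H i w)" by (simp add: summable_iff_convergent)
    then have "convergent (\<lambda>n. H n w - H 0 w)" using sum_lessThan_telescope[of "\<lambda>i. H i w"] by simp
    then have "convergent (\<lambda>n. H n w)" by (simp add: convergent_diff_const_right_iff)
    then show ?case unfolding D_def by (simp add: convergent_LIMSEQ_iff)
  qed
  have D: "(\<lambda>w. D w - H n w) \<in> sq_integrable M \<and> sq_norm M (\<lambda>w. D w - H n w) \<le> c * (1/2)^n" for n
  proof -
    have "(\<integral>\<^sup>+w. ennreal ((norm (D w - H n w))\<^sup>2) \<partial>M) =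
        (\<integral>\<^sup>+w. liminf (\<lambda>k. ennreal ((norm (H k w - H n w))\<^sup>2)) \<partial>M)"
    proof (rule nn_integral_cong_AE, use lim in eventually_elim)
      case (elim w)
      then have "(\<lambda>k. ennreal ((norm (H k w - H n w))\<^sup>2)) \<longlonglongrightarrow> ennreal ((norm (D w - H n w))\<^sup>2)"
        by (intro tendsto_intros)
      then show ?case by (rule lim_imp_Liminf[OF sequentially_bot, symmetric])
    qed
    also have "\<dots> \<le> liminf (\<lambda>k. \<integral>\<^sup>+w. ennreal ((norm (H k w - H n w))\<^sup>2) \<partial>M)"
      by (rule nn_integral_liminf) measurable
    also have "\<dots> \<le> liminf (\<lambda>k. ennreal ((c * (1/2)^n)\<^sup>2))"
    proof (rule Liminf_mono)
      show "\<forall>\<^sub>F k in sequentially. (\<integral>\<^sup>+w. ennreal ((norm (H k w - H n w))\<^sup>2) \<partial>M) \<le> ennreal ((c * (1/2)^n)\<^sup>2)"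
        using eventually_ge_at_top[of n]
      proof eventually_elim
        case (elim k)
        show ?case
          unfolding nn_integral_sq_norm[OF sq_integrable_diff[OF H H]]
          using cauchy[OF elim] by (intro ennreal_leI power_mono) auto
      qed
    qed
    also have "\<dots> = ennreal ((c * (1/2)^n)\<^sup>2)" by (simp add: Liminf_const)
    finally show ?thesis
      using c by (intro conjI sq_norm_leI[where c="c * (1/2)^n"]) auto
  qed
  have "D \<in> sq_integrable M"
    using sq_integrable_add[OF conjunct1[OF D[of 0]] H[of 0]] by simp
  then show ?thesis using D by blast
qed

text \<open>If \<open>D\<close> represents \<open>L\<close>, then
  \<open>J H = (sq_norm M H)\<^sup>2 - 2 * L H\<close> is the squared distance from \<open>H\<close>
  to \<open>D\<close> up to a constant. So \<open>D\<close> is found by minimising \<open>J\<close>,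
  and the first variation at the minimum is the representation.\<close>

lemma (in prob_space) riesz_representation_sq_integrable:
  fixes L :: "('a \<Rightarrow> 'b::euclidean_space) \<Rightarrow> real"
  assumes "bounded_linear_functional M L"
  shows "\<exists>D\<in>sq_integrable M. \<forall>H\<in>sq_integrable M. L H = (\<integral>w. D w \<bullet> H w \<partial>M)"
proof -
  have add: "\<And>H K. H \<in> sq_integrable M \<Longrightarrow> K \<in> sq_integrable M \<Longrightarrow> L (\<lambda>w. H w + K w) = L H + L K"
    and scale: "\<And>c H. H \<in> sq_integrable M \<Longrightarrow> L (\<lambda>w. c *\<^sub>R H w) = c * L H"
    using assms by (auto simp: bounded_linear_functional_def)
  obtain C where C: "\<And>H. H \<in> sq_integrable M \<Longrightarrow> \<bar>L H\<bar> \<le> C * sq_norm M H"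
    using assms unfolding bounded_linear_functional_def by blast
  have diff: "L (\<lambda>w. H w - K w) = L H - L K" if "H \<in> sq_integrable M" "K \<in> sq_integrable M" for H K
    using add[OF that(1) sq_integrable_scaleR[OF that(2), of "-1"]] scale[OF that(2), of "-1"] by simp
  define J where "J H = (sq_norm M H)\<^sup>2 - 2 * L H" for H
  define m where "m = (INF H\<in>sq_integrable M. J H)"
  \<comment> \<open>Completing the square with the bound \<open>C\<close> of
    \<open>L\<close>.\<close>
  have "- C\<^sup>2 \<le> J H" if "H \<in> sq_integrable M" for H
  proof -
    have "L H \<le> C * sq_norm M H" using C[OF that] by simp
    then show ?thesis
      using zero_le_power2[of "sq_norm M H - C"] by (simp add: J_def power2_diff algebra_simps)
  qed
  then have bdd: "bdd_below (J ` sq_integrable M)" by (auto intro!: bdd_belowI2)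
  have ne: "sq_integrable M \<noteq> ({} :: ('a \<Rightarrow> 'b) set)"
    using sq_norm_le_const(1)[of "\<lambda>_. 0" 0] by auto
  have m_le: "m \<le> J H" if "H \<in> sq_integrable M" for H
    unfolding m_def using bdd that by (rule cINF_lower)
  \<comment> \<open>\<open>J\<close> controls squared distances, so tolerance 1/4^n yields the
    Cauchy rate 1/2^n.\<close>
  have "\<exists>H\<in>sq_integrable M. J H < m + (1/4)^n" for n :: nat
    using cINF_less_iff[OF ne bdd, of "m + (1/4)^n"] unfolding m_def by simp
  then obtain H where H: "\<And>n. H n \<in> sq_integrable M" "\<And>n. J (H n) < m + (1/4)^n"
    by metis
  have "sq_norm M (\<lambda>w. H k w - H n w) \<le> 2 * (1/2)^n" if "n \<le> k" for n k :: nat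
  proof (rule power2_le_imp_le)
    let ?I = "\<integral>w. H k w \<bullet> H n w \<partial>M"
    \<comment> \<open>Parallelogram argument: the midpoint cannot go below \<open>m\<close>, so two
      near minimisers are close to each other.\<close>
    have "m \<le> J (\<lambda>w. (1/2) *\<^sub>R (H k w + H n w))"
      by (intro m_le sq_integrable_scaleR sq_integrable_add H)
    also have "\<dots> = (1/4) * ((sq_norm M (H k))\<^sup>2 + 2 * ?I + (sq_norm M (H n))\<^sup>2) - (L (H k) + L (H n))"
      unfolding J_def sq_norm_scaleR power_mult_distrib sq_norm_add_power2[OF H(1) H(1)]
        scale[OF sq_integrable_add[OF H(1) H(1)]] add[OF H(1) H(1)]
      by (simp add: power2_eq_square field_simps)
    finally have "m \<le> (1/4) * ((sq_norm M (H k))\<^sup>2 + 2 * ?I + (sq_norm M (H n))\<^sup>2) - (L (H k) + L (H n))" .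
    moreover have "(sq_norm M (\<lambda>w. H k w - H n w))\<^sup>2 = (sq_norm M (H k))\<^sup>2 - 2 * ?I + (sq_norm M (H n))\<^sup>2"
      by (rule sq_norm_diff_power2[OF H(1) H(1)])
    ultimately have "(sq_norm M (\<lambda>w. H k w - H n w))\<^sup>2 \<le> 2 * J (H k) + 2 * J (H n) - 4 * m"
      unfolding J_def by argo
    also have "\<dots> \<le> 2 * (1/4)^k + 2 * (1/4)^n" using H(2)[of k] H(2)[of n] by simp
    also have "\<dots> \<le> 2 * (1/4)^n + 2 * (1/4)^n"
      using that by (intro add_mono mult_left_mono power_decreasing) auto
    also have "\<dots> = (2 * (1/2)^n)\<^sup>2"
      by (simp add: power_mult_distrib power2_eq_square power_mult_distrib[symmetric])
    finally show "(sq_norm M (\<lambda>w. H k w - H n w))\<^sup>2 \<le> (2 * (1/2)^n)\<^sup>2" .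
  qed simp
  from sq_integrable_complete[OF H(1) this] obtain D where
    D: "D \<in> sq_integrable M" and DH: "\<And>n. sq_norm M (\<lambda>w. D w - H n w) \<le> 2 * (1/2)^n" by blast
  have to0: "(\<lambda>n. sq_norm M (\<lambda>w. D w - H n w)) \<longlonglongrightarrow> 0"
  proof (rule real_tendsto_sandwich[OF _ _ tendsto_const])
    show "(\<lambda>n. 2 * (1/2)^n :: real) \<longlonglongrightarrow> 0" by (intro tendsto_mult_right_zero LIMSEQ_power_zero) simp
  qed (use DH in auto)
  have "(\<lambda>n. sq_norm M (H n)) \<longlonglongrightarrow> sq_norm M D"
  proof (rule Lim_transform_bound[OF _ to0, THEN LIM_zero_cancel])
    have "\<bar>sq_norm M (H n) - sq_norm M D\<bar> \<le> sq_norm M (\<lambda>w. D w - H n w)" for n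
      using sq_norm_le_add_diff[OF D H(1)[of n]] sq_norm_le_add_diff[OF H(1)[of n] D]
        sq_norm_minus_commute[of M D "H n"] by linarith
    then show "\<forall>\<^sub>F n in sequentially. norm (sq_norm M (H n) - sq_norm M D) \<le> norm (sq_norm M (\<lambda>w. D w - H n w))"
      by simp
  qed
  moreover have "(\<lambda>n. L (H n)) \<longlonglongrightarrow> L D"
  proof (rule Lim_transform_bound[OF _ tendsto_mult_right_zero[OF to0, of C], THEN LIM_zero_cancel])
    have "\<bar>L (H n) - L D\<bar> \<le> C * sq_norm M (\<lambda>w. D w - H n w)" for n
      using C[OF sq_integrable_diff[OF D H(1)[of n]]] diff[OF D H(1)[of n]] by simp
    then show "\<forall>\<^sub>F n in sequentially. norm (L (H n) - L D) \<le> norm (C * sq_norm M (\<lambda>w. D w - H n w))"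
      by (simp add: order_trans[OF _ abs_ge_self] del: abs_mult)
  qed
  ultimately have "(\<lambda>n. J (H n)) \<longlonglongrightarrow> J D" unfolding J_def by (intro tendsto_intros)
  moreover have "(\<lambda>n. m + (1/4)^n) \<longlonglongrightarrow> m + 0"
    by (intro tendsto_intros LIMSEQ_power_zero) simp
  ultimately have JD: "J D \<le> m"
    using H(2) by (intro LIMSEQ_le[of "\<lambda>n. J (H n)"]) (auto intro: less_imp_le)
  have "L H = (\<integral>w. D w \<bullet> H w \<partial>M)" if H: "H \<in> sq_integrable M" for H
  proof -
    have "0 \<le> 2 * s * ((\<integral>w. D w \<bullet> H w \<partial>M) - L H) + s\<^sup>2 * (sq_norm M H)\<^sup>2" for s
    proof -
      have "J D \<le> J (\<lambda>w. D w + s *\<^sub>R H w)"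
        using JD m_le[OF sq_integrable_add[OF D sq_integrable_scaleR[OF H]]] by (rule order_trans)
      also have "\<dots> = J D + 2 * s * ((\<integral>w. D w \<bullet> H w \<partial>M) - L H) + s\<^sup>2 * (sq_norm M H)\<^sup>2"
        unfolding J_def sq_norm_add_power2[OF D sq_integrable_scaleR[OF H]] sq_norm_scaleR
          add[OF D sq_integrable_scaleR[OF H]] scale[OF H]
        by (simp add: power_mult_distrib algebra_simps)
      finally show ?thesis by simp
    qed
    then have "(\<integral>w. D w \<bullet> H w \<partial>M) - L H = 0" by (rule quadratic_nonneg_imp_zero)
    then show ?thesis by simp
  qed
  then show ?thesis using D by blast
qed

section \<open>Copies of random variables on atomless spaces\<close>

text \<open>A subset \<open>C\<close> of \<open>B\<close> with strictly smaller positive measure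
  leaves \<open>B - C\<close> of positive measure, and one of the two has at most half the measure
  of \<open>B\<close>. Repeated halving gets below \<open>e\<close>.\<close>

lemma (in finite_measure) atomless_small_subset:
  assumes "atomless M" "A \<in> sets M" "0 < measure M A" "0 < e"
  shows "\<exists>B\<in>sets M. B \<subseteq> A \<and> 0 < measure M B \<and> measure M B < e"
proof -
  have "\<exists>B\<in>sets M. B \<subseteq> A \<and> 0 < measure M B \<and> measure M B \<le> measure M A / 2 ^ n" for n
  proof (induction n)
    case 0
    then show ?case using assms by auto
  next
    case (Suc n)
    then obtain B where B: "B \<in> sets M" "B \<subseteq> A" "0 < measure M B" "measure M B \<le> measure M A / 2 ^ n"
      by blast
    then obtain C where C: "C \<in> sets M" "C \<subseteq> B" "0 < measure M C" "measure M C < measure M B"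
      using assms(1) by (auto simp: atomless_def emeasure_eq_measure ennreal_less_iff)
    have D: "measure M (B - C) = measure M B - measure M C"
      using B C by (intro finite_measure_Diff) auto
    show ?case
    proof (cases "measure M C \<le> measure M B / 2")
      case True
      then show ?thesis using B C by (intro bexI[of _ C]) auto
    next
      case False
      then show ?thesis using B C D by (intro bexI[of _ "B - C"]) auto
    qed
  qed
  moreover obtain n where "measure M A * (1/2) ^ n < e"
  proof -
    have "(\<lambda>n. measure M A * (1/2) ^ n) \<longlonglongrightarrow> 0"
      by (intro tendsto_mult_right_zero LIMSEQ_power_zero) simp
    then have "\<forall>\<^sub>F n in sequentially. measure M A * (1/2) ^ n < e"
      using \<open>0 < e\<close> by (rule order_tendstoD)
    then show ?thesis using that by (auto simp: eventually_sequentially)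
  qed
  ultimately show ?thesis by (metis order_le_less_trans power_one_over times_divide_eq_right mult.right_neutral)
qed

text \<open>Sierpinski's theorem, by greedy exhaustion: each set grows by at least half of what can
  still be gained without exceeding \<open>t\<close>.\<close>

lemma (in finite_measure) atomless_subset_of_measure:
  assumes "atomless M" "A \<in> sets M" "0 \<le> t" "t \<le> measure M A"
  shows "\<exists>B\<in>sets M. B \<subseteq> A \<and> measure M B = t"
proof -
  define S where "S C = {E \<in> sets M. C \<subseteq> E \<and> E \<subseteq> A \<and> measure M E \<le> t}" for C
  define s where "s C = (SUP E\<in>S C. measure M E)" for C
  have bdd: "bdd_above (measure M ` S C)" for C by (auto simp: S_def)
  have step: "\<exists>E\<in>S C. (measure M C + s C) / 2 \<le> measure M E" if "C \<in> S {}" for C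
  proof (cases "measure M C < s C")
    case True
    have "C \<in> S C" using that by (auto simp: S_def)
    then have "S C \<noteq> {}" by auto
    moreover have "(measure M C + s C) / 2 < s C" using True by simp
    ultimately show ?thesis
      unfolding s_def by (subst (asm) less_cSUP_iff[OF _ bdd]) (auto intro: less_imp_le)
  next
    case False
    then show ?thesis using that by (intro bexI[of _ C]) (auto simp: S_def)
  qed
  have "\<exists>C. \<forall>n. C n \<in> S {} \<and> (C (Suc n) \<in> S (C n) \<and> (measure M (C n) + s (C n)) / 2 \<le> measure M (C (Suc n)))"
  proof (intro dependent_nat_choice)
    show "\<exists>C. C \<in> S {}" using assms by (intro exI[of _ "{}"]) (auto simp: S_def)
    show "\<exists>E. E \<in> S {} \<and> (E \<in> S C \<and> (measure M C + s C) / 2 \<le> measure M E)" if "C \<in> S {}" for C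
      using step[OF that] by (auto simp: S_def)
  qed
  then obtain C where C: "\<And>n. C n \<in> S {}" "\<And>n. C (Suc n) \<in> S (C n)"
      "\<And>n. (measure M (C n) + s (C n)) / 2 \<le> measure M (C (Suc n))" by blast
  define U where "U = (\<Union>n. C n)"
  have inc: "incseq C" using C(2) by (intro incseq_SucI) (auto simp: S_def)
  have sets: "range C \<subseteq> sets M" using C(1) by (auto simp: S_def)
  have lim: "(\<lambda>n. measure M (C n)) \<longlonglongrightarrow> measure M U"
    unfolding U_def by (rule finite_Lim_measure_incseq[OF sets inc])
  have U: "U \<in> sets M" "U \<subseteq> A" using sets C(1) by (auto simp: U_def S_def)
  have Ut: "measure M U \<le> t"
    using C(1) by (intro LIMSEQ_le_const2[OF lim]) (auto simp: S_def)
  have "measure M U = t"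
  proof (rule ccontr)
    assume "measure M U \<noteq> t"
    then have less: "measure M U < t" using Ut by simp
    have "measure M (A - U) = measure M A - measure M U"
      using U assms by (intro finite_measure_Diff) auto
    \<comment> \<open>A gap below \<open>t\<close> leaves room for a set \<open>E\<close> disjoint
      from \<open>U\<close>. As \<open>U \<union> E\<close> is admissible over every
      \<open>C n\<close>, the greedy steps would push the limit beyond
      \<open>measure M U\<close>.\<close>
    then obtain E where E: "E \<in> sets M" "E \<subseteq> A - U" "0 < measure M E" "measure M E < t - measure M U"
      using atomless_small_subset[OF assms(1), of "A - U" "t - measure M U"] less assms U by auto
    have UE: "measure M (U \<union> E) = measure M U + measure M E"
      using U E by (intro finite_measure_Union) auto
    have "U \<union> E \<in> S (C n)" for n
      using U E UE by (auto simp: S_def U_def)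
    then have *: "measure M U + measure M E \<le> s (C n)" for n
      unfolding s_def UE[symmetric] by (intro cSUP_upper bdd)
    have **: "(measure M (C n) + (measure M U + measure M E)) / 2 \<le> measure M (C (Suc n))" for n
      using C(3)[of n] *[of n] by (simp add: field_simps)
    have "(\<lambda>n. (measure M (C n) + (measure M U + measure M E)) / 2) \<longlonglongrightarrow>
        (measure M U + (measure M U + measure M E)) / 2"
      by (intro tendsto_intros lim) simp
    then have "(measure M U + (measure M U + measure M E)) / 2 \<le> measure M U"
      by (rule LIMSEQ_le[OF _ LIMSEQ_Suc[OF lim]]) (use ** in auto)
    then show False using E by simp
  qed
  then show ?thesis using U by blast
qed

text \<open>Pieces of measure \<open>v j\<close> are cut off one after the other. \<open>R n\<close>
  is what remains after \<open>n\<close> cuts, and the intersection is null because the weights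
  exhaust the measure of \<open>A\<close>.\<close>

lemma (in finite_measure) atomless_countable_partition:
  fixes v :: "nat \<Rightarrow> real"
  assumes "atomless M" "A \<in> sets M" "\<And>j. 0 \<le> v j" "v sums measure M A"
  shows "\<exists>q\<in>measurable M (count_space UNIV). \<forall>j. measure M {w\<in>A. q w = j} = v j"
proof -
  have le: "(\<Sum>i<n. v i) \<le> measure M A" for n
    using assms(3,4) sum_le_suminf[of v "{..<n}"] by (auto simp: sums_iff)
  have "\<exists>R. (\<forall>n. R n \<in> sets M \<and> R n \<subseteq> A \<and> measure M (R n) = measure M A - (\<Sum>i<n. v i)) \<and>
    (\<forall>n. R (Suc n) \<subseteq> R n) \<and> R 0 = A"
  proof -
    \<comment> \<open>The clause for \<open>n = 0\<close> records the starting set, which dependent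
      choice would otherwise forget.\<close>
    have "\<exists>R. \<forall>n. (R n \<in> sets M \<and> R n \<subseteq> A \<and> measure M (R n) = measure M A - (\<Sum>i<n. v i) \<and> (n = 0 \<longrightarrow> R n = A))
      \<and> R (Suc n) \<subseteq> R n"
    proof (intro dependent_nat_choice)
      show "\<exists>R. R \<in> sets M \<and> R \<subseteq> A \<and> measure M R = measure M A - (\<Sum>i<0. v i) \<and> (0 = (0::nat) \<longrightarrow> R = A)"
        using assms by auto
      fix R n
      assume R: "R \<in> sets M \<and> R \<subseteq> A \<and> measure M R = measure M A - (\<Sum>i<n. v i) \<and> (n = 0 \<longrightarrow> R = A)"
      then show "\<exists>R'. (R' \<in> sets M \<and> R' \<subseteq> A \<and> measure M R' = measure M A - (\<Sum>i<Suc n. v i) \<and> (Suc n = 0 \<longrightarrow> R' = A))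
          \<and> R' \<subseteq> R"
        using atomless_subset_of_measure[OF assms(1), of R "measure M A - (\<Sum>i<Suc n. v i)"]
          le[of "Suc n"] assms(3)[of n] by auto
    qed
    then show ?thesis by metis
  qed
  then obtain R where R: "\<And>n. R n \<in> sets M" "\<And>n. R n \<subseteq> A"
      "\<And>n. measure M (R n) = measure M A - (\<Sum>i<n. v i)" "\<And>n. R (Suc n) \<subseteq> R n" "R 0 = A"
    by blast
  have [measurable]: "R n \<in> sets M" for n by (rule R)
  have dec: "decseq R" using R(4) by (rule decseq_SucI)
  \<comment> \<open>Since \<open>R 0 = A\<close>, a point of \<open>A\<close> can first be missing
    from \<open>R (Suc 0)\<close>; \<open>q w = j\<close> says that it is lost between
    \<open>R j\<close> and \<open>R (Suc j)\<close>. On the null intersection the value is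
    arbitrary.\<close>
  define q where "q w = (LEAST n. w \<notin> R (Suc n))" for w
  have q[measurable]: "q \<in> measurable M (count_space UNIV)" unfolding q_def by measurable
  have "(\<lambda>n. measure M (R n)) \<longlonglongrightarrow> measure M A - measure M A"
    unfolding R(3) using assms(4) by (intro tendsto_intros) (simp add: sums_def)
  moreover have "(\<lambda>n. measure M (R n)) \<longlonglongrightarrow> measure M (\<Inter>n. R n)"
    using R(1) dec by (intro finite_Lim_measure_decseq) auto
  ultimately have "measure M (\<Inter>n. R n) = 0" using LIMSEQ_unique by fastforce
  then have "(\<Inter>n. R n) \<in> null_sets M"
    by (simp add: null_sets_def emeasure_eq_measure)
  then have ae: "AE w in M. w \<notin> (\<Inter>n. R n)" by (rule AE_not_in)
  have "measure M {w\<in>A. q w = j} = v j" for j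
  proof -
    have "measure M {w\<in>A. q w = j} = measure M (R j - R (Suc j))"
    proof (rule finite_measure_eq_AE)
      show "AE w in M. w \<in> {w\<in>A. q w = j} \<longleftrightarrow> w \<in> R j - R (Suc j)"
        using ae
      proof eventually_elim
        case (elim w)
        show ?case
        proof
          assume w: "w \<in> {w\<in>A. q w = j}"
          then have "\<exists>n. w \<notin> R (Suc n)"
            using elim R(5) by (metis INT_iff mem_Collect_eq not0_implies_Suc)
          then have "w \<notin> R (Suc j)" using LeastI_ex[of "\<lambda>n. w \<notin> R (Suc n)"] w by (simp add: q_def)
          moreover have "w \<in> R j"
            using w not_less_Least[of "j - 1" "\<lambda>n. w \<notin> R (Suc n)"] R(5)
            by (cases j) (auto simp: q_def)
          ultimately show "w \<in> R j - R (Suc j)" by simp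
        next
          assume w: "w \<in> R j - R (Suc j)"
          have "w \<in> R (Suc n)" if "n < j" for n
            using w decseqD[OF dec, of "Suc n" j] that by auto
          then have "q w = j"
            unfolding q_def using w by (intro Least_equality) (auto simp: not_less[symmetric])
          then show "w \<in> {w\<in>A. q w = j}" using w R(2) by auto
        qed
      qed
      show "{w\<in>A. q w = j} \<in> sets M"
        using assms(2) sets.sets_into_space[OF assms(2)]
        by (rule_tac back_subst[of "\<lambda>B. B \<in> sets M", of "A \<inter> {w\<in>space M. q w = j}"]) (measurable, auto)
    qed measurable
    also have "\<dots> = v j" using R by (subst finite_measure_Diff) auto
    finally show ?thesis .
  qed
  then show ?thesis using q by blast
qed

text \<open>Every cell of \<open>c\<close> is partitioned on its own; countability of the values of
  \<open>c\<close> makes the pasted label measurable.\<close>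

lemma (in finite_measure) atomless_label_of_weights:
  fixes c :: "'a \<Rightarrow> 'c::countable" and v :: "'c \<Rightarrow> nat \<Rightarrow> real"
  assumes "atomless M" and c[measurable]: "c \<in> measurable M (count_space UNIV)"
    and "\<And>k j. 0 \<le> v k j" "\<And>k. v k sums measure M {w\<in>space M. c w = k}"
  shows "\<exists>q\<in>measurable M (count_space UNIV). \<forall>k j. measure M {w\<in>space M. c w = k \<and> q w = j} = v k j"
proof -
  have "\<exists>q\<in>measurable M (count_space UNIV). \<forall>j. measure M {w\<in>{w\<in>space M. c w = k}. q w = j} = v k j" for k
    using assms by (intro atomless_countable_partition) auto
  then have "\<exists>q. \<forall>k. q k \<in> measurable M (count_space UNIV) \<and>
      (\<forall>j. measure M {w\<in>{w\<in>space M. c w = k}. q k w = j} = v k j)"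
    by (intro choice) blast
  then obtain q where q[measurable]: "\<And>k. q k \<in> measurable M (count_space UNIV)"
    and qv: "\<And>k j. measure M {w\<in>{w\<in>space M. c w = k}. q k w = j} = v k j" by blast
  have "(\<lambda>w. q (c w) w) \<in> measurable M (count_space UNIV)"
    by (rule measurable_compose_countable[OF _ c]) (rule q)
  moreover have "measure M {w\<in>space M. c w = k \<and> q (c w) w = j} = v k j" for k j
    unfolding qv[of k j, symmetric] by (rule arg_cong[where f="measure M"]) auto
  ultimately show ?thesis by (intro bexI[of _ "\<lambda>w. q (c w) w"]) auto
qed

section \<open>Joint laws of countable labels and their limits\<close>

lemma (in prob_space) distr_count_space_eq_iff:
  fixes c c' :: "'a \<Rightarrow> 'c::countable"
  assumes [measurable]: "c \<in> measurable M (count_space UNIV)" "c' \<in> measurable M (count_space UNIV)"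
  shows "distr M (count_space UNIV) c = distr M (count_space UNIV) c' \<longleftrightarrow>
    (\<forall>k. prob {w\<in>space M. c w = k} = prob {w\<in>space M. c' w = k})"
proof -
  have e: "emeasure (distr M (count_space UNIV) f) {k} = prob {w\<in>space M. f w = k}"
    if [measurable]: "f \<in> measurable M (count_space UNIV)" for f :: "'a \<Rightarrow> 'c" and k
    by (subst emeasure_distr)
      (auto simp: emeasure_eq_measure intro!: arg_cong[where f="measure M"])
  show ?thesis
  proof
    assume "distr M (count_space UNIV) c = distr M (count_space UNIV) c'"
    then show "\<forall>k. prob {w\<in>space M. c w = k} = prob {w\<in>space M. c' w = k}"
      using e[OF assms(1)] e[OF assms(2)] by simp
  next
    assume *: "\<forall>k. prob {w\<in>space M. c w = k} = prob {w\<in>space M. c' w = k}"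
    show "distr M (count_space UNIV) c = distr M (count_space UNIV) c'"
      by (rule measure_eqI_countable[of _ UNIV]) (use * e[OF assms(1)] e[OF assms(2)] in auto)
  qed
qed

lemma (in prob_space) sums_prob_eq:
  assumes q[measurable]: "q \<in> measurable M (count_space UNIV)" and [measurable]: "A \<in> sets M"
  shows "(\<lambda>j::nat. prob {w\<in>A. q w = j}) sums prob A"
proof -
  have [simp]: "{w\<in>A. q w = j} \<in> sets M" for j
    using sets.sets_into_space[OF assms(2)]
    by (rule_tac back_subst[of "\<lambda>B. B \<in> sets M", of "A \<inter> {w\<in>space M. q w = j}"]) (measurable, auto)
  have "(\<lambda>j. prob {w\<in>A. q w = j}) sums prob (\<Union>j. {w\<in>A. q w = j})"
    by (rule finite_measure_UNION) (auto simp: disjoint_family_on_def)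
  also have "(\<Union>j. {w\<in>A. q w = j}) = A" by auto
  finally show ?thesis .
qed

text \<open>The prescribed weights are the joint probabilities of \<open>c'\<close> and
  \<open>q'\<close>. Summed over the second label they give the cell probabilities of
  \<open>c'\<close>, which equality of laws identifies with those of \<open>c\<close>, as the
  partition requires.\<close>

lemma (in prob_space) atomless_label_copy:
  fixes c c' :: "'a \<Rightarrow> 'c::countable" and q' :: "'a \<Rightarrow> nat"
  assumes "atomless M"
    and [measurable]: "c \<in> measurable M (count_space UNIV)" "c' \<in> measurable M (count_space UNIV)"
      "q' \<in> measurable M (count_space UNIV)"
    and eq: "distr M (count_space UNIV) c = distr M (count_space UNIV) c'"
  shows "\<exists>q\<in>measurable M (count_space UNIV).
    distr M (count_space UNIV) (\<lambda>w. (c w, q w)) = distr M (count_space UNIV) (\<lambda>w. (c' w, q' w))"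
proof -
  have "(\<lambda>j. prob {w\<in>space M. c' w = k \<and> q' w = j}) sums prob {w\<in>space M. c w = k}" for k
    using sums_prob_eq[of q' "{w\<in>space M. c' w = k}"] eq
    by (simp add: distr_count_space_eq_iff conj_assoc)
  then obtain q where q[measurable]: "q \<in> measurable M (count_space UNIV)"
    and "\<And>k j. prob {w\<in>space M. c w = k \<and> q w = j} = prob {w\<in>space M. c' w = k \<and> q' w = j}"
    using atomless_label_of_weights[OF assms(1,2), of "\<lambda>k j. prob {w\<in>space M. c' w = k \<and> q' w = j}"]
    by auto
  moreover have "(\<lambda>w. (c w, q w)) \<in> measurable M (count_space UNIV)"
      "(\<lambda>w. (c' w, q' w)) \<in> measurable M (count_space UNIV)"
    by (auto intro!: measurable_compose_countable[OF _ assms(2)] measurable_compose_countable[OF _ assms(3)]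
        simp: measurable_compose[OF q] measurable_compose[OF assms(4)])
  ultimately have "distr M (count_space UNIV) (\<lambda>w. (c w, q w)) = distr M (count_space UNIV) (\<lambda>w. (c' w, q' w))"
    by (subst distr_count_space_eq_iff) auto
  then show ?thesis using q by blast
qed

text \<open>Dominated convergence passes to integrals of bounded continuous functions. These
  determine the probabilities of closed sets, an intersection stable generator of the Borel
  sets.\<close>

lemma (in prob_space) distr_eq_limit:
  fixes Z Z' :: "nat \<Rightarrow> 'a \<Rightarrow> 'b::metric_space" and W W' :: "'a \<Rightarrow> 'b"
  assumes [measurable]: "\<And>n. Z n \<in> borel_measurable M" "\<And>n. Z' n \<in> borel_measurable M"
      "W \<in> borel_measurable M" "W' \<in> borel_measurable M"
    and eq: "\<And>n. distr M borel (Z n) = distr M borel (Z' n)"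
    and lim: "AE w in M. (\<lambda>n. Z n w) \<longlonglongrightarrow> W w" "AE w in M. (\<lambda>n. Z' n w) \<longlonglongrightarrow> W' w"
  shows "distr M borel W = distr M borel W'"
proof -
  have cont: "(\<integral>w. f (W w) \<partial>M) = (\<integral>w. f (W' w) \<partial>M)"
    if f: "continuous_on UNIV f" and b: "\<And>z. \<bar>f z\<bar> \<le> 1" for f :: "'b \<Rightarrow> real"
  proof -
    have [measurable]: "f \<in> borel_measurable borel"
      using f by (rule borel_measurable_continuous_onI)
    have l: "(\<lambda>n. \<integral>w. f (V n w) \<partial>M) \<longlonglongrightarrow> (\<integral>w. f (U w) \<partial>M)"
      if [measurable]: "\<And>n. V n \<in> borel_measurable M" "U \<in> borel_measurable M"
        and lm: "AE w in M. (\<lambda>n. V n w) \<longlonglongrightarrow> U w" for V U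
    proof (rule integral_dominated_convergence[where w="\<lambda>_. 1"])
      show "AE w in M. (\<lambda>n. f (V n w)) \<longlonglongrightarrow> f (U w)"
        using lm by eventually_elim (rule continuous_on_tendsto_compose[OF f], auto)
    qed (use b in auto)
    have "(\<integral>w. f (Z n w) \<partial>M) = (\<integral>w. f (Z' n w) \<partial>M)" for n
      using arg_cong[OF eq[of n], of "\<lambda>N. \<integral>z. f z \<partial>N"] by (simp add: integral_distr)
    then have "(\<lambda>n. \<integral>w. f (Z n w) \<partial>M) \<longlonglongrightarrow> (\<integral>w. f (W' w) \<partial>M)"
      using l[of Z' W', OF _ _ lim(2)] by simp
    with l[of Z W, OF _ _ lim(1)] show ?thesis by (auto intro: LIMSEQ_unique)
  qed
  have closed: "prob {w\<in>space M. W w \<in> C} = prob {w\<in>space M. W' w \<in> C}" if C: "closed C" for C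
  \<comment> \<open>\<open>infdist\<close> to the empty set is 0 by convention; for other closed
    sets distance 0 characterises membership.\<close>
  proof (cases "C = {}")
    case False
    \<comment> \<open>Continuous functions that decrease to the indicator of
      \<open>C\<close>.\<close>
    define f where "f k z = max 0 (1 - real k * infdist z C)" for k z
    have fc: "continuous_on UNIV (f k)" for k
      unfolding f_def by (intro continuous_intros)
    have [measurable]: "f k \<in> borel_measurable borel" for k
      using fc by (rule borel_measurable_continuous_onI)
    have [measurable]: "C \<in> sets borel" using C by simp
    have f1: "\<bar>f k z\<bar> \<le> 1" for k z
      using infdist_nonneg[of z C] by (simp add: f_def)
    have flim: "(\<lambda>k. f k z) \<longlonglongrightarrow> indicator C z" for z
    proof (cases "z \<in> C")
      case True
      then show ?thesis by (simp add: f_def)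
    next
      case z: False
      then have pos: "infdist z C > 0"
        using in_closed_iff_infdist_zero[OF C False] infdist_nonneg[of z C] by (simp add: less_le)
      obtain N :: nat where N: "1 < real N * infdist z C" using ex_less_of_nat_mult[OF pos] by blast
      have "f k z = 0" if "N \<le> k" for k
      proof -
        have "real N * infdist z C \<le> real k * infdist z C"
          using that pos by (intro mult_right_mono) auto
        then show ?thesis using N by (simp add: f_def)
      qed
      then have "\<forall>\<^sub>F k in sequentially. f k z = indicator C z"
        using z by (auto simp: eventually_sequentially)
      then show ?thesis by (rule tendsto_eventually)
    qed
    have l: "(\<lambda>k. \<integral>w. f k (U w) \<partial>M) \<longlonglongrightarrow> prob {w\<in>space M. U w \<in> C}"
      if [measurable]: "U \<in> borel_measurable M" for U
    proof -
      have "(\<lambda>k. \<integral>w. f k (U w) \<partial>M) \<longlonglongrightarrow> (\<integral>w. indicator C (U w) \<partial>M)"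
        by (rule integral_dominated_convergence[where w="\<lambda>_. 1"]) (use f1 flim in auto)
      also have "(\<integral>w. indicator C (U w) \<partial>M :: real) = (\<integral>w. indicator {w\<in>space M. U w \<in> C} w \<partial>M)"
        by (rule Bochner_Integration.integral_cong) (auto simp: indicator_def)
      also have "\<dots> = prob {w\<in>space M. U w \<in> C}" by simp
      finally show ?thesis .
    qed
    show ?thesis
      using l[of W] l[of W'] cont[OF fc f1] by (auto intro: LIMSEQ_unique)
  qed simp
  show ?thesis
  proof (rule measure_eqI_generator_eq[where E="{C. closed C}" and \<Omega>=UNIV and A="\<lambda>_. UNIV"])
    show "Int_stable {C::'b set. closed C}" by (auto simp: Int_stable_def)
    show "emeasure (distr M borel W) C = emeasure (distr M borel W') C" if "C \<in> {C. closed C}" for C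
      using that closed[of C]
      by (auto simp: emeasure_distr emeasure_eq_measure vimage_def Int_def conj_commute)
    show "emeasure (distr M borel W) UNIV \<noteq> \<infinity>" for i :: nat by (simp add: emeasure_distr)
  qed (simp_all add: borel_eq_closed)
qed

text \<open>One dense sequence \<open>d\<close> serves all scales; only the label map, the first
  index within \<open>e\<close>, depends on \<open>e\<close>. Labels of different scales are thus
  decoded by the same \<open>d\<close>.\<close>

lemma ex_countable_quantization:
  "\<exists>d::nat \<Rightarrow> 'b::{metric_space, second_countable_topology}. \<forall>e>0.
    \<exists>l\<in>measurable borel (count_space UNIV). \<forall>y. dist (d (l y)) y < e"
proof -
  obtain D :: "'b set" where D: "countable D" "\<And>X. open X \<Longrightarrow> X \<noteq> {} \<Longrightarrow> \<exists>d\<in>D. d \<in> X"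
    by (erule countable_dense_setE)
  define d where "d = from_nat_into D"
  have ex: "\<exists>k. dist (d k) y < e" if "0 < e" for y e
  proof -
    obtain z where "z \<in> D" "dist y z < e" using D(2)[of "ball y e"] \<open>0 < e\<close> by auto
    moreover obtain k where "from_nat_into D k = z"
      using from_nat_into_surj[OF D(1) \<open>z \<in> D\<close>] by blast
    ultimately show ?thesis by (auto simp: d_def dist_commute)
  qed
  have "\<exists>l\<in>measurable borel (count_space UNIV). \<forall>y. dist (d (l y)) y < e" if "0 < e" for e
  proof (intro bexI allI)
    show "(\<lambda>y. LEAST k. dist (d k) y < e) \<in> measurable borel (count_space UNIV)" by measurable
    show "dist (d (LEAST k. dist (d k) y < e)) y < e" for y
      using LeastI_ex[OF ex[OF that, of y]] .
  qed
  then show ?thesis by blast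
qed

lemma measurable_Pair_count_space:
  fixes f :: "'a \<Rightarrow> 'c::countable" and g :: "'a \<Rightarrow> 'd::countable"
  assumes f: "f \<in> measurable M (count_space UNIV)" and g: "g \<in> measurable M (count_space UNIV)"
  shows "(\<lambda>w. (f w, g w)) \<in> measurable M (count_space UNIV)"
  by (rule measurable_compose_countable[OF _ f], rule measurable_compose[OF g]) simp

lemma distr_compose_eq:
  assumes "distr M N f = distr M N g" "f \<in> measurable M N" "g \<in> measurable M N" "h \<in> measurable N K"
  shows "distr M K (\<lambda>w. h (f w)) = distr M K (\<lambda>w. h (g w))"
proof -
  have "distr M K (h \<circ> f) = distr M K (h \<circ> g)"
    using assms by (simp flip: distr_distr)
  then show ?thesis by (simp add: comp_def)
qed

text \<open>Given a label \<open>a\<close> with the law of \<open>a'\<close>, one cannot in general find \<open>Y\<close> on the same space with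
  \<open>(a, Y)\<close> distributed as \<open>(a', Y')\<close>; for countably many labels atomlessness suffices. \<open>Y\<close> is the
  limit of a Markov chain of labels that copies the successive quantizations of \<open>Y'\<close>.\<close>

lemma (in prob_space) atomless_coupling:
  fixes a a' :: "'a \<Rightarrow> 'c::countable" and Y' :: "'a \<Rightarrow> 'b::euclidean_space"
    and u :: "'c \<Rightarrow> 'd::{metric_space, second_countable_topology}"
  assumes at: "atomless M"
    and a[measurable]: "a \<in> measurable M (count_space UNIV)" "a' \<in> measurable M (count_space UNIV)"
    and Y'[measurable]: "Y' \<in> borel_measurable M"
    and eq: "distr M (count_space UNIV) a = distr M (count_space UNIV) a'"
  shows "\<exists>Y\<in>borel_measurable M.
    distr M borel (\<lambda>w. (u (a w), Y w)) = distr M borel (\<lambda>w. (u (a' w), Y' w))"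
proof -
  let ?C = "measurable M (count_space UNIV)"
  obtain d :: "nat \<Rightarrow> 'b" where
    "\<forall>e>0. \<exists>l\<in>measurable borel (count_space UNIV). \<forall>y. dist (d (l y)) y < e"
    using ex_countable_quantization by blast
  then have "\<exists>l\<in>measurable borel (count_space UNIV). \<forall>y. dist (d (l y)) y < (1/2)^n" for n :: nat
    by simp
  then have "\<exists>l. \<forall>n. l n \<in> measurable borel (count_space UNIV) \<and> (\<forall>y. dist (d (l n y)) y < (1/2)^n)"
    by (intro choice) blast
  then obtain l where l[measurable]: "\<And>n. l n \<in> measurable borel (count_space UNIV)"
    and ld: "\<And>n y. dist (d (l n y)) y < (1/2)^n" by blast
  define q' where "q' n w = l n (Y' w)" for n w
  have q'[measurable]: "q' n \<in> ?C" for n unfolding q'_def by measurable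
  \<comment> \<open>The invariant is the joint law of \<open>a\<close> and the current label. The
    transition also keeps two consecutive labels together, since the distance between their values
    depends on both.\<close>
  have "\<exists>q. \<forall>n. (q n \<in> ?C \<and> distr M (count_space UNIV) (\<lambda>w. (a w, q n w)) = distr M (count_space UNIV) (\<lambda>w. (a' w, q' n w)))
    \<and> distr M (count_space UNIV) (\<lambda>w. ((a w, q n w), q (Suc n) w)) =
        distr M (count_space UNIV) (\<lambda>w. ((a' w, q' n w), q' (Suc n) w))"
  proof (intro dependent_nat_choice)
    show "\<exists>q. q \<in> ?C \<and> distr M (count_space UNIV) (\<lambda>w. (a w, q w)) = distr M (count_space UNIV) (\<lambda>w. (a' w, q' 0 w))"
      using atomless_label_copy[OF at a q' eq] by blast
    fix q n
    assume q: "q \<in> ?C \<and> distr M (count_space UNIV) (\<lambda>w. (a w, q w)) = distr M (count_space UNIV) (\<lambda>w. (a' w, q' n w))"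
    then obtain r where r: "r \<in> ?C" "distr M (count_space UNIV) (\<lambda>w. ((a w, q w), r w)) =
        distr M (count_space UNIV) (\<lambda>w. ((a' w, q' n w), q' (Suc n) w))"
      using atomless_label_copy[OF at _ _ q'[of "Suc n"], of "\<lambda>w. (a w, q w)" "\<lambda>w. (a' w, q' n w)"]
      by (auto intro: measurable_Pair_count_space a q')
    \<comment> \<open>The older label is dropped: the next copy only needs the joint law of
      \<open>a\<close> and the latest label.\<close>
    have "distr M (count_space UNIV) (\<lambda>w. (a w, r w)) = distr M (count_space UNIV) (\<lambda>w. (a' w, q' (Suc n) w))"
      using distr_compose_eq[OF r(2), of "\<lambda>((x, y), z). (x, z)" "count_space UNIV"] q r(1)
      by (simp add: measurable_Pair_count_space a q')
    then show "\<exists>r. (r \<in> ?C \<and> distr M (count_space UNIV) (\<lambda>w. (a w, r w)) = distr M (count_space UNIV) (\<lambda>w. (a' w, q' (Suc n) w)))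
      \<and> distr M (count_space UNIV) (\<lambda>w. ((a w, q w), r w)) =
        distr M (count_space UNIV) (\<lambda>w. ((a' w, q' n w), q' (Suc n) w))"
      using r by blast
  qed
  then obtain q where q[measurable]: "\<And>n. q n \<in> ?C"
    and q1: "\<And>n. distr M (count_space UNIV) (\<lambda>w. (a w, q n w)) = distr M (count_space UNIV) (\<lambda>w. (a' w, q' n w))"
    and q2: "\<And>n. distr M (count_space UNIV) (\<lambda>w. ((a w, q n w), q (Suc n) w)) =
        distr M (count_space UNIV) (\<lambda>w. ((a' w, q' n w), q' (Suc n) w))" by blast
  have ddu[measurable]: "\<And>n. (\<lambda>w. d (q n w)) \<in> borel_measurable M" "\<And>n. (\<lambda>w. d (q' n w)) \<in> borel_measurable M"
      "(\<lambda>w. u (a w)) \<in> borel_measurable M" "(\<lambda>w. u (a' w)) \<in> borel_measurable M"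
    by (auto intro: measurable_compose[OF q] measurable_compose[OF q'] measurable_compose[OF a(1)]
        measurable_compose[OF a(2)])
  define Y where "Y w = lim (\<lambda>n. d (q n w))" for w
  have Y[measurable]: "Y \<in> borel_measurable M"
    unfolding Y_def by (rule borel_measurable_lim_metric) (rule ddu)
  \<comment> \<open>Closeness of consecutive values is a property of the joint law of consecutive
    labels, so it passes from the quantizations of \<open>Y'\<close> to their copies.\<close>
  have close: "AE w in M. dist (d (q (Suc n) w)) (d (q n w)) \<le> 2 * (1/2)^n" for n
  proof -
    let ?P = "\<lambda>((x, i), j). dist (d j) (d i) \<le> 2 * (1/2)^n"
    have "dist (d (q' (Suc n) w)) (d (q' n w)) \<le> 2 * (1/2)^n" for w
    proof -
      have "dist (d (q' (Suc n) w)) (d (q' n w)) \<le> (1/2)^Suc n + (1/2)^n"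
        using ld[of "Suc n" "Y' w"] ld[of n "Y' w"] dist_triangle2[of "d (q' (Suc n) w)" "d (q' n w)" "Y' w"]
        unfolding q'_def by linarith
      also have "\<dots> \<le> 2 * (1/2)^n" by simp
      finally show ?thesis .
    qed
    then have "AE z in distr M (count_space UNIV) (\<lambda>w. ((a' w, q' n w), q' (Suc n) w)). ?P z"
      by (subst AE_distr_iff) (auto intro!: measurable_Pair_count_space a q')
    then have "AE z in distr M (count_space UNIV) (\<lambda>w. ((a w, q n w), q (Suc n) w)). ?P z"
      unfolding q2 .
    then show ?thesis
      by (subst (asm) AE_distr_iff) (auto intro!: measurable_Pair_count_space a q)
  qed
  have "AE w in M. \<forall>n. dist (d (q (Suc n) w)) (d (q n w)) \<le> 2 * (1/2)^n"
    using close by (simp add: AE_all_countable)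
  then have lim: "AE w in M. (\<lambda>n. d (q n w)) \<longlonglongrightarrow> Y w"
  proof (rule AE_mp, intro AE_I2 impI)
    fix w
    assume *: "\<forall>n. dist (d (q (Suc n) w)) (d (q n w)) \<le> 2 * (1/2)^n"
    have "summable (\<lambda>n. 2 * (1/2)^n :: real)" by (intro summable_mult summable_geometric) simp
    then have "summable (\<lambda>n. d (q (Suc n) w) - d (q n w))"
      by (rule summable_comparison_test'[where N=0]) (use * in \<open>simp flip: dist_norm\<close>)
    then have "convergent (\<lambda>n. \<Sum>i<n. d (q (Suc i) w) - d (q i w))" by (simp add: summable_iff_convergent)
    then have "convergent (\<lambda>n. d (q n w) - d (q 0 w))"
      using sum_lessThan_telescope[of "\<lambda>i. d (q i w)"] by simp
    then have "convergent (\<lambda>n. d (q n w))" by (simp add: convergent_diff_const_right_iff)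
    then show "(\<lambda>n. d (q n w)) \<longlonglongrightarrow> Y w" unfolding Y_def by (simp add: convergent_LIMSEQ_iff)
  qed
  have lim': "(\<lambda>n. d (q' n w)) \<longlonglongrightarrow> Y' w" for w
  proof (rule metric_LIMSEQ_I)
    fix r :: real assume "0 < r"
    have "(\<lambda>n. (1/2)^n :: real) \<longlonglongrightarrow> 0" by (intro LIMSEQ_power_zero) simp
    then have "\<forall>\<^sub>F n in sequentially. (1/2)^n < r" using \<open>0 < r\<close> by (rule order_tendstoD)
    then show "\<exists>N. \<forall>n\<ge>N. dist (d (q' n w)) (Y' w) < r"
      unfolding eventually_sequentially q'_def using less_trans[OF ld] by blast
  qed
  have "distr M borel (\<lambda>w. (u (a w), Y w)) = distr M borel (\<lambda>w. (u (a' w), Y' w))"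
  proof (rule distr_eq_limit[where Z="\<lambda>n w. (u (a w), d (q n w))" and Z'="\<lambda>n w. (u (a' w), d (q' n w))"])
    show "distr M borel (\<lambda>w. (u (a w), d (q n w))) = distr M borel (\<lambda>w. (u (a' w), d (q' n w)))" for n
      using distr_compose_eq[OF q1[of n], of "\<lambda>(x, i). (u x, d i)" borel]
      by (simp add: measurable_Pair_count_space a q q')
    show "AE w in M. (\<lambda>n. (u (a w), d (q n w))) \<longlonglongrightarrow> (u (a w), Y w)"
      using lim by eventually_elim (intro tendsto_intros)
    show "AE w in M. (\<lambda>n. (u (a' w), d (q' n w))) \<longlonglongrightarrow> (u (a' w), Y' w)"
      using lim' by (intro AE_I2 tendsto_intros)
  qed measurable
  then show ?thesis using Y by blast
qed

section \<open>Conditionally independent copies of a label\<close>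

lemma (in prob_space) nn_integral_label:
  fixes c :: "'a \<Rightarrow> 'c::countable"
  assumes c[measurable]: "c \<in> measurable M (count_space UNIV)"
  shows "(\<integral>\<^sup>+w. f (c w) \<partial>M) = (\<integral>\<^sup>+k. f k * ennreal (prob {w\<in>space M. c w = k}) \<partial>count_space UNIV)"
proof -
  have "distr M (count_space UNIV) c = density (count_space UNIV) (\<lambda>k. ennreal (prob {w\<in>space M. c w = k}))"
  proof (rule measure_eqI_countable[of _ UNIV])
    fix k
    have "c -` {k} \<inter> space M = {w\<in>space M. c w = k}" by auto
    then show "emeasure (distr M (count_space UNIV) c) {k} =
        emeasure (density (count_space UNIV) (\<lambda>k. ennreal (prob {w\<in>space M. c w = k}))) {k}"
      by (simp add: emeasure_distr emeasure_density emeasure_eq_measure nn_integral_count_space_indicator[symmetric]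
        flip: nn_integral_count_space_indicator)
  qed auto
  then have "(\<integral>\<^sup>+w. f (c w) \<partial>M) =
      (\<integral>\<^sup>+k. f k \<partial>density (count_space UNIV) (\<lambda>k. ennreal (prob {w\<in>space M. c w = k})))"
    by (subst nn_integral_distr[symmetric, of c M "count_space UNIV"]) auto
  then show ?thesis by (simp add: nn_integral_density mult.commute)
qed

lemma nn_integral_count_space_swap:
  fixes f :: "'c \<Rightarrow> 'd \<Rightarrow> ennreal"
  shows "(\<integral>\<^sup>+x. \<integral>\<^sup>+y. f x y \<partial>count_space UNIV \<partial>count_space UNIV) =
    (\<integral>\<^sup>+y. \<integral>\<^sup>+x. f x y \<partial>count_space UNIV \<partial>count_space UNIV)"
  using nn_integral_fst_count_space[of "\<lambda>(x, y). f x y"] nn_integral_snd_count_space[of "\<lambda>(x, y). f x y"]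
  by simp

text \<open>If every value exceeded the average, the average would be finite, and integrating
  against weights of total mass 1 would put it strictly above itself. Values of \<open>G\<close> may
  be infinite.\<close>

lemma ex_le_weighted_average:
  fixes r :: "nat \<Rightarrow> real" and G :: "nat \<Rightarrow> ennreal"
  assumes r: "\<And>m. 0 \<le> r m" "r sums 1"
  shows "\<exists>m. G m \<le> (\<integral>\<^sup>+m. G m * ennreal (r m) \<partial>count_space UNIV)"
proof (rule ccontr)
  let ?A = "\<integral>\<^sup>+m. G m * ennreal (r m) \<partial>count_space UNIV"
  assume "\<not> ?thesis"
  then have less: "?A < G m" for m by (simp add: not_le)
  then have fin: "?A < \<top>" using order_less_le_trans top_greatest by blast
  have A: "(\<integral>\<^sup>+m. ?A * ennreal (r m) \<partial>count_space UNIV) = ?A"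
    using r by (simp add: nn_integral_cmult nn_integral_count_space_nat suminf_ennreal2 sums_iff)
  have "\<exists>m. r m \<noteq> 0"
  proof (rule ccontr)
    assume "\<nexists>m. r m \<noteq> 0"
    then have "r = (\<lambda>_. 0)" by auto
    then show False using r(2) sums_unique2[OF sums_zero] by force
  qed
  then obtain m where m: "0 < r m" using r(1) by (auto simp: less_le)
  have "(\<integral>\<^sup>+m. ?A * ennreal (r m) \<partial>count_space UNIV) < ?A"
  proof (rule nn_integral_less)
    show "\<not> (AE m in count_space UNIV. G m * ennreal (r m) \<le> ?A * ennreal (r m))"
      using ennreal_mult_strict_right_mono[OF less[of m], of "ennreal (r m)"] m
      by (auto simp: AE_count_space not_le intro!: exI[of _ m])
    show "AE m in count_space UNIV. ?A * ennreal (r m) \<le> G m * ennreal (r m)"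
      using less by (intro AE_I2 mult_right_mono) (auto intro: less_imp_le)
  qed (use fin A in auto)
  then show False unfolding A by simp
qed

text \<open>\<open>i\<close> is conditionally independent of \<open>j\<close> given
  \<open>a\<close>, with the same conditional law. Within a cell of \<open>a\<close> the cost of
  \<open>i\<close> is then a weighted average of the costs of constant choices, so some constant
  does at least as well; \<open>\<iota>\<close> collects these constants.\<close>

lemma (in prob_space) atomless_conditional_copy:
  fixes a j :: "'a \<Rightarrow> nat"
  assumes at: "atomless M"
    and [measurable]: "a \<in> measurable M (count_space UNIV)" "j \<in> measurable M (count_space UNIV)"
  shows "\<exists>i\<in>measurable M (count_space UNIV).
    distr M (count_space UNIV) (\<lambda>w. (a w, i w)) = distr M (count_space UNIV) (\<lambda>w. (a w, j w)) \<and>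
    (\<forall>\<phi>. \<exists>\<iota>. (\<integral>\<^sup>+w. \<phi> (j w) (\<iota> (a w)) \<partial>M) \<le> (\<integral>\<^sup>+w. \<phi> (j w) (i w) \<partial>M))"
proof -
  define p where "p k = prob {w\<in>space M. a w = k}" for k
  define pp where "pp k l = prob {w\<in>space M. a w = k \<and> j w = l}" for k l
  \<comment> \<open>Joint weights under conditional independence. If \<open>p k = 0\<close> the
    quotient is 0 by convention, in agreement with \<open>pp k l = 0\<close>.\<close>
  define v where "v = (\<lambda>(k, l) m. pp k l * pp k m / p k)"
  have pos: "0 \<le> p k" "0 \<le> pp k l" for k l by (auto simp: p_def pp_def)
  have pp_sums: "pp k sums p k" for k
    using sums_prob_eq[of j "{w\<in>space M. a w = k}"] by (simp add: p_def pp_def[abs_def] conj_assoc)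
  have pp0: "pp k l = 0" if "p k = 0" for k l
  proof -
    have "pp k l \<le> p k" unfolding p_def pp_def by (intro finite_measure_mono) auto
    then show ?thesis using that pos(2)[of k l] by simp
  qed
  have aj: "(\<lambda>w. (a w, j w)) \<in> measurable M (count_space UNIV)"
    by (intro measurable_Pair_count_space) measurable
  have "v kl sums prob {w\<in>space M. (a w, j w) = kl}" for kl
  proof (cases kl)
    case (Pair k l)
    have "(\<lambda>m. pp k l * pp k m / p k) sums (pp k l * p k / p k)"
      by (intro sums_divide sums_mult pp_sums)
    moreover have "pp k l * p k / p k = pp k l" using pp0[of k l] by auto
    ultimately show ?thesis unfolding Pair by (simp add: v_def pp_def)
  qed
  moreover have "0 \<le> v kl m" for kl m using pos by (auto simp: v_def split: prod.split)
  ultimately obtain i where i[measurable]: "i \<in> measurable M (count_space UNIV)"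
    and iv: "\<And>k l m. prob {w\<in>space M. (a w = k \<and> j w = l) \<and> i w = m} = v (k, l) m"
    using atomless_label_of_weights[OF at aj, of v] by (auto simp: prod_eq_iff)
  have ai: "(\<lambda>w. (a w, i w)) \<in> measurable M (count_space UNIV)"
    and aji: "(\<lambda>w. ((a w, j w), i w)) \<in> measurable M (count_space UNIV)"
    by (intro measurable_Pair_count_space aj; measurable)+
  have "prob {w\<in>space M. a w = k \<and> i w = m} = pp k m" for k m
  proof -
    have "{w\<in>space M. a w = k \<and> i w = m} \<in> events" by measurable
    then have s1: "(\<lambda>l. v (k, l) m) sums prob {w\<in>space M. a w = k \<and> i w = m}"
      using sums_prob_eq[of j "{w\<in>space M. a w = k \<and> i w = m}"]
      by (simp add: iv[symmetric] conj_ac)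
    have s2: "(\<lambda>l. v (k, l) m) sums (p k * pp k m / p k)"
      using sums_divide[OF sums_mult2[OF pp_sums[of k], of "pp k m"], of "p k"] by (simp add: v_def)
    have "p k * pp k m / p k = pp k m" using pp0[of k m] by auto
    then show ?thesis using sums_unique2[OF s1 s2] by simp
  qed
  then have "distr M (count_space UNIV) (\<lambda>w. (a w, i w)) = distr M (count_space UNIV) (\<lambda>w. (a w, j w))"
    by (subst distr_count_space_eq_iff[OF ai aj]) (auto simp: pp_def)
  moreover have "\<exists>\<iota>. (\<integral>\<^sup>+w. \<phi> (j w) (\<iota> (a w)) \<partial>M) \<le> (\<integral>\<^sup>+w. \<phi> (j w) (i w) \<partial>M)" for \<phi>
  proof -
    \<comment> \<open>The share of the cost that comes from cell \<open>k\<close> when the constant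
      \<open>m\<close> is chosen there.\<close>
    define G where "G k m = (\<integral>\<^sup>+l. \<phi> l m * ennreal (pp k l) \<partial>count_space UNIV)" for k m
    have "\<exists>m. G k m \<le> (\<integral>\<^sup>+m. G k m * ennreal (pp k m / p k) \<partial>count_space UNIV)" for k
    proof (cases "p k = 0")
      case True
      then show ?thesis by (simp add: G_def pp0)
    next
      case False
      have "(\<lambda>m. pp k m / p k) sums (p k / p k)" by (intro sums_divide pp_sums)
      then show ?thesis using False pos by (intro ex_le_weighted_average) auto
    qed
    then obtain \<iota> where \<iota>: "\<And>k. G k (\<iota> k) \<le> (\<integral>\<^sup>+m. G k m * ennreal (pp k m / p k) \<partial>count_space UNIV)"
      by metis
    have "(\<integral>\<^sup>+w. \<phi> (j w) (\<iota> (a w)) \<partial>M) =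
        (\<integral>\<^sup>+k. \<integral>\<^sup>+l. \<phi> l (\<iota> k) * ennreal (pp k l) \<partial>count_space UNIV \<partial>count_space UNIV)"
      using nn_integral_label[OF aj, of "\<lambda>(k, l). \<phi> l (\<iota> k)"]
      by (simp add: pp_def case_prod_beta prod_eq_iff flip: nn_integral_fst_count_space)
    also have "\<dots> \<le> (\<integral>\<^sup>+k. \<integral>\<^sup>+m. G k m * ennreal (pp k m / p k) \<partial>count_space UNIV \<partial>count_space UNIV)"
      using \<iota>[unfolded G_def] unfolding G_def by (rule nn_integral_mono)
    also have "\<dots> = (\<integral>\<^sup>+k. \<integral>\<^sup>+m. \<integral>\<^sup>+l. \<phi> l m * ennreal (v (k, l) m)
        \<partial>count_space UNIV \<partial>count_space UNIV \<partial>count_space UNIV)"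
    proof (intro nn_integral_cong)
      fix k m
      have "ennreal (v (k, l) m) = ennreal (pp k l) * ennreal (pp k m / p k)" for l
        using pos by (simp add: v_def ennreal_mult[symmetric])
      then show "G k m * ennreal (pp k m / p k) = (\<integral>\<^sup>+l. \<phi> l m * ennreal (v (k, l) m) \<partial>count_space UNIV)"
        by (simp add: G_def nn_integral_multc[symmetric] mult.assoc)
    qed
    also have "\<dots> = (\<integral>\<^sup>+k. \<integral>\<^sup>+l. \<integral>\<^sup>+m. \<phi> l m * ennreal (v (k, l) m)
        \<partial>count_space UNIV \<partial>count_space UNIV \<partial>count_space UNIV)"
      by (intro nn_integral_cong nn_integral_count_space_swap)
    also have "\<dots> = (\<integral>\<^sup>+w. \<phi> (j w) (i w) \<partial>M)"
      using nn_integral_label[OF aji, of "\<lambda>((k, l), m). \<phi> l m"]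
      by (simp add: iv[symmetric] case_prod_beta prod_eq_iff flip: nn_integral_fst_count_space)
    finally show ?thesis by blast
  qed
  ultimately show ?thesis using i by blast
qed

section \<open>The derivative of a law invariant functional\<close>

lemma distr_eq_sq_integrable:
  fixes f :: "'c::topological_space \<Rightarrow> 'b::euclidean_space"
  assumes eq: "distr M borel Z = distr M borel Z'"
    and [measurable]: "Z \<in> borel_measurable M" "Z' \<in> borel_measurable M" "f \<in> borel_measurable borel"
  shows "(\<lambda>w. f (Z w)) \<in> sq_integrable M \<longleftrightarrow> (\<lambda>w. f (Z' w)) \<in> sq_integrable M"
    and "sq_norm M (\<lambda>w. f (Z w)) = sq_norm M (\<lambda>w. f (Z' w))"
proof -
  have "integrable M (\<lambda>w. (norm (f (Z w)))\<^sup>2) \<longleftrightarrow> integrable M (\<lambda>w. (norm (f (Z' w)))\<^sup>2)"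
    using arg_cong[OF eq, of "\<lambda>N. integrable N (\<lambda>z. (norm (f z))\<^sup>2)"]
    by (simp add: integrable_distr_eq)
  then show "(\<lambda>w. f (Z w)) \<in> sq_integrable M \<longleftrightarrow> (\<lambda>w. f (Z' w)) \<in> sq_integrable M"
    by (simp add: sq_integrable_def)
  show "sq_norm M (\<lambda>w. f (Z w)) = sq_norm M (\<lambda>w. f (Z' w))"
    unfolding sq_norm_def
    using arg_cong[OF eq, of "\<lambda>N. \<integral>z. (norm (f z))\<^sup>2 \<partial>N"] by (simp add: integral_distr)
qed

lemma distr_eq_integral:
  fixes f :: "'c::topological_space \<Rightarrow> real"
  assumes eq: "distr M borel Z = distr M borel Z'"
    and [measurable]: "Z \<in> borel_measurable M" "Z' \<in> borel_measurable M" "f \<in> borel_measurable borel"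
  shows "(\<integral>w. f (Z w) \<partial>M) = (\<integral>w. f (Z' w) \<partial>M)"
  using arg_cong[OF eq, of "\<lambda>N. \<integral>z. f z \<partial>N"] by (simp add: integral_distr)

lemma (in prob_space) sq_integrable_near:
  assumes "Y \<in> sq_integrable M" "Z \<in> borel_measurable M" "AE w in M. norm (Y w - Z w) \<le> c"
  shows "Z \<in> sq_integrable M" "sq_norm M (\<lambda>w. Y w - Z w) \<le> c" "sq_norm M Z \<le> sq_norm M Y + c"
proof -
  have "(\<lambda>w. Y w - Z w) \<in> borel_measurable M" using assms sq_integrableD(1)[OF assms(1)] by simp
  note * = sq_norm_le_const[OF this assms(3)]
  show Z: "Z \<in> sq_integrable M" using sq_integrable_diff[OF assms(1) *(1)] by simp
  show "sq_norm M (\<lambda>w. Y w - Z w) \<le> c" by (rule *(2))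
  then show "sq_norm M Z \<le> sq_norm M Y + c"
    using sq_norm_le_add_diff[OF Z assms(1)] sq_norm_minus_commute[of M Y Z] by simp
qed

lemma integral_inner_add:
  assumes "D \<in> sq_integrable M" "H \<in> sq_integrable M" "K \<in> sq_integrable M"
  shows "(\<integral>w. D w \<bullet> (H w + K w) \<partial>M) = (\<integral>w. D w \<bullet> H w \<partial>M) + (\<integral>w. D w \<bullet> K w \<partial>M)"
  using assms by (simp add: inner_add_right integrable_inner_sq_integrable)

lemma integral_inner_diff:
  assumes "D \<in> sq_integrable M" "H \<in> sq_integrable M" "K \<in> sq_integrable M"
  shows "(\<integral>w. D w \<bullet> (H w - K w) \<partial>M) = (\<integral>w. D w \<bullet> H w \<partial>M) - (\<integral>w. D w \<bullet> K w \<partial>M)"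
  using assms by (simp add: inner_diff_right integrable_inner_sq_integrable)

section \<open>Existence and uniqueness of the derivative as an element of L^2\<close>

lemma bounded_linear_functional_inner:
  assumes "D \<in> sq_integrable M"
  shows "bounded_linear_functional M (\<lambda>H. \<integral>w. D w \<bullet> H w \<partial>M)"
  unfolding bounded_linear_functional_def
  using integral_inner_add[OF assms] sq_norm_cauchy_schwarz[OF assms] by auto

lemma has_frechet_derivative_at_iff:
  "has_frechet_derivative_at M F X D \<longleftrightarrow> D \<in> sq_integrable M \<and>
    (\<forall>e>0. \<exists>r>0. \<forall>H\<in>sq_integrable M. sq_norm M H < r \<longrightarrow>
      \<bar>F (\<lambda>w. X w + H w) - F X - (\<integral>w. D w \<bullet> H w \<partial>M)\<bar> \<le> e * sq_norm M H)"
  unfolding has_frechet_derivative_at_def has_frechet_differential_def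
  using bounded_linear_functional_inner by auto

lemma (in prob_space) ex_frechet_derivative:
  assumes "frechet_differentiable_at M F X"
  shows "\<exists>D. has_frechet_derivative_at M F X D"
proof -
  obtain L where L: "has_frechet_differential M F X L"
    using assms by (auto simp: frechet_differentiable_at_def)
  then obtain D where D: "D \<in> sq_integrable M" "\<And>H. H \<in> sq_integrable M \<Longrightarrow> L H = (\<integral>w. D w \<bullet> H w \<partial>M)"
    using riesz_representation_sq_integrable[of L] by (auto simp: has_frechet_differential_def)
  then have "has_frechet_derivative_at M F X D"
    using L by (simp add: has_frechet_derivative_at_iff has_frechet_differential_def)
  then show ?thesis by blast
qed

text \<open>In the direction \<open>K = D - E\<close> the two expansions differ by \<open>t\<close>
  times the squared norm of \<open>K\<close>, yet by at most a small multiple of \<open>t\<close>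
  times its norm.\<close>

lemma (in prob_space) frechet_derivative_unique:
  assumes "has_frechet_derivative_at M F X D" "has_frechet_derivative_at M F X E"
  shows "AE w in M. D w = E w"
proof -
  have D: "D \<in> sq_integrable M" and E: "E \<in> sq_integrable M"
    using assms by (auto simp: has_frechet_derivative_at_iff)
  define K where "K w = D w - E w" for w
  have K: "K \<in> sq_integrable M" unfolding K_def by (rule sq_integrable_diff[OF D E])
  have "(sq_norm M K)\<^sup>2 \<le> 0 + e" if "0 < e" for e
  proof -
    \<comment> \<open>Chosen so that the final bound \<open>2 * e' * (sq_norm M K + 1)\<close>
      equals \<open>e\<close>; adding 1 avoids a zero denominator.\<close>
    define e' where "e' = e / (2 * (sq_norm M K + 1))"
    have e': "0 < e'" using \<open>0 < e\<close> by (auto simp: e'_def intro!: divide_pos_pos add_nonneg_pos)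
    obtain r1 where r1: "0 < r1" "\<And>H. H \<in> sq_integrable M \<Longrightarrow> sq_norm M H < r1 \<Longrightarrow>
        \<bar>F (\<lambda>w. X w + H w) - F X - (\<integral>w. D w \<bullet> H w \<partial>M)\<bar> \<le> e' * sq_norm M H"
      using assms(1) e' unfolding has_frechet_derivative_at_iff by meson
    obtain r2 where r2: "0 < r2" "\<And>H. H \<in> sq_integrable M \<Longrightarrow> sq_norm M H < r2 \<Longrightarrow>
        \<bar>F (\<lambda>w. X w + H w) - F X - (\<integral>w. E w \<bullet> H w \<partial>M)\<bar> \<le> e' * sq_norm M H"
      using assms(2) e' unfolding has_frechet_derivative_at_iff by meson
    define t where "t = min r1 r2 / (sq_norm M K + 1)"
    have pos: "0 < sq_norm M K + 1" by (simp add: add_nonneg_pos)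
    have t: "0 < t" using r1(1) r2(1) pos by (simp add: t_def)
    have "t * sq_norm M K < t * (sq_norm M K + 1)" using t by simp
    also have "\<dots> = min r1 r2" using pos by (simp add: t_def)
    finally have small: "sq_norm M (\<lambda>w. t *\<^sub>R K w) < min r1 r2" using t by (simp add: sq_norm_scaleR)
    note tK = sq_integrable_scaleR[OF K, of t]
    have "\<bar>(\<integral>w. D w \<bullet> (t *\<^sub>R K w) \<partial>M) - (\<integral>w. E w \<bullet> (t *\<^sub>R K w) \<partial>M)\<bar> \<le> 2 * (e' * sq_norm M (\<lambda>w. t *\<^sub>R K w))"
      using r1(2)[OF tK] r2(2)[OF tK] small by linarith
    moreover have "(\<integral>w. D w \<bullet> (t *\<^sub>R K w) \<partial>M) - (\<integral>w. E w \<bullet> (t *\<^sub>R K w) \<partial>M) = t * (sq_norm M K)\<^sup>2"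
    proof -
      have "(\<integral>w. D w \<bullet> (t *\<^sub>R K w) \<partial>M) - (\<integral>w. E w \<bullet> (t *\<^sub>R K w) \<partial>M) =
          (\<integral>w. D w \<bullet> (t *\<^sub>R K w) - E w \<bullet> (t *\<^sub>R K w) \<partial>M)"
        by (intro Bochner_Integration.integral_diff[symmetric] integrable_inner_sq_integrable D E tK)
      also have "\<dots> = (\<integral>w. t * (norm (K w))\<^sup>2 \<partial>M)"
        by (intro Bochner_Integration.integral_cong)
          (auto simp: K_def power2_norm_eq_inner inner_diff_left algebra_simps)
      finally show ?thesis by (simp add: sq_norm_power2)
    qed
    ultimately have "t * (sq_norm M K)\<^sup>2 \<le> t * (2 * e' * sq_norm M K)"
      using t by (simp add: sq_norm_scaleR)
    then have "(sq_norm M K)\<^sup>2 \<le> 2 * e' * sq_norm M K" using t by simp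
    also have "\<dots> \<le> 2 * e' * (sq_norm M K + 1)" using e' by simp
    also have "\<dots> = e" using pos by (simp add: e'_def field_simps)
    finally show ?thesis by simp
  qed
  then have "(sq_norm M K)\<^sup>2 \<le> 0" by (rule field_le_epsilon)
  then have "sq_norm M K = 0" by simp
  then show ?thesis using sq_norm_eq_0_iff[OF K] by (simp add: K_def)
qed

text \<open>If \<open>i\<close> is a copy of the label \<open>j\<close> of \<open>D\<close> with the same joint law with the label \<open>a\<close> of \<open>X\<close>,
  then \<open>X + t D\<close> has the law of a perturbation of \<open>X\<close> close to \<open>X + t d\<^sub>i\<close>. Law invariance then
  forces \<open>D \<bullet> d\<^sub>i\<close> to have almost the mean of \<open>\<bar>D\<bar>\<^sup>2\<close>, that is, \<open>d\<^sub>i\<close> to be close to \<open>D\<close>.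
  Choosing \<open>i\<close> conditionally independent of \<open>j\<close> shows that \<open>D\<close> is close to a function of \<open>a\<close>.\<close>

lemma (in prob_space) frechet_derivative_near_function:
  fixes F :: "('a \<Rightarrow> 'b::euclidean_space) \<Rightarrow> real"
  assumes at: "atomless M" and law: "law_invariant M F" and X: "X \<in> sq_integrable M"
    and FD: "has_frechet_derivative_at M F X D" and e: "0 < e" "e \<le> 1"
  shows "\<exists>h\<in>borel_measurable borel. (\<lambda>w. h (X w)) \<in> sq_integrable M \<and>
    sq_norm M (\<lambda>w. D w - h (X w)) \<le> 2 * e + sqrt (e * (12 * sq_norm M D + 9))"
proof -
  have D: "D \<in> sq_integrable M" using FD by (simp add: has_frechet_derivative_at_iff)
  have [measurable]: "X \<in> borel_measurable M" "D \<in> borel_measurable M"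
    using X D by (auto dest: sq_integrableD)
  define N where "N = sq_norm M D"
  have N: "0 \<le> N" by (simp add: N_def)
  obtain r where r: "0 < r" "\<And>H. H \<in> sq_integrable M \<Longrightarrow> sq_norm M H < r \<Longrightarrow>
      \<bar>F (\<lambda>w. X w + H w) - F X - (\<integral>w. D w \<bullet> H w \<partial>M)\<bar> \<le> e * sq_norm M H"
    using FD e(1) unfolding has_frechet_derivative_at_iff by meson
  \<comment> \<open>The copy built below perturbs \<open>X\<close> by at most
    \<open>t * (N + 4)\<close> in norm; this \<open>t\<close> keeps that under
    \<open>r\<close>.\<close>
  define t where "t = r / (N + 5)"
  have t: "0 < t" "t * (N + 5) = r" using r N by (auto simp: t_def)
  have te: "0 < t * e" using t e by simp
  obtain d :: "nat \<Rightarrow> 'b" where d: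
    "\<forall>e>0. \<exists>l\<in>measurable borel (count_space UNIV). \<forall>y. dist (d (l y)) y < e"
    using ex_countable_quantization by blast
  \<comment> \<open>Displacing \<open>X\<close> within its cell adds directly to a perturbation of
    size about \<open>t\<close>, hence the scale \<open>t * e\<close>. The values of the label of
    \<open>D\<close> get multiplied by \<open>t\<close>, so scale \<open>e\<close> is enough
    there.\<close>
  obtain lX where lX[measurable]: "lX \<in> measurable borel (count_space UNIV)"
    and lXd: "\<And>y. dist (d (lX y)) y < t * e" using d te by blast
  obtain lD where lD[measurable]: "lD \<in> measurable borel (count_space UNIV)"
    and lDd: "\<And>y. dist (d (lD y)) y < e" using d e by blast
  define a where "a w = lX (X w)" for w
  define j where "j w = lD (D w)" for w
  have a[measurable]: "a \<in> measurable M (count_space UNIV)" unfolding a_def by measurable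
  have j[measurable]: "j \<in> measurable M (count_space UNIV)" unfolding j_def by measurable
  obtain i where i[measurable]: "i \<in> measurable M (count_space UNIV)"
    and eq: "distr M (count_space UNIV) (\<lambda>w. (a w, i w)) = distr M (count_space UNIV) (\<lambda>w. (a w, j w))"
    and opt: "\<And>\<phi>. \<exists>\<iota>. (\<integral>\<^sup>+w. \<phi> (j w) (\<iota> (a w)) \<partial>M) \<le> (\<integral>\<^sup>+w. \<phi> (j w) (i w) \<partial>M)"
    using atomless_conditional_copy[OF at a j] by blast
  note ai = measurable_Pair_count_space[OF a i]
  note aj = measurable_Pair_count_space[OF a j]
  have dm: "(\<lambda>w. d (f w)) \<in> borel_measurable M" if "f \<in> measurable M (count_space UNIV)" for f
    using that by (rule measurable_compose) simp
  have [measurable]: "(\<lambda>w. d (a w)) \<in> borel_measurable M" "(\<lambda>w. d (i w)) \<in> borel_measurable M"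
      "(\<lambda>w. d (j w)) \<in> borel_measurable M" by (intro dm a i j)+
  define Y' where "Y' w = X w + t *\<^sub>R D w" for w
  have Y'sq: "Y' \<in> sq_integrable M"
    unfolding Y'_def by (intro sq_integrable_add sq_integrable_scaleR X D)
  have Y'm[measurable]: "Y' \<in> borel_measurable M" unfolding Y'_def by measurable
  \<comment> \<open>Jointly with the label of \<open>X\<close>, \<open>Y\<close> is to
    \<open>i\<close> what \<open>X + t D\<close> is to \<open>j\<close>; the labels enter through
    their representatives.\<close>
  obtain Y where Y[measurable]: "Y \<in> borel_measurable M"
    and YY: "distr M borel (\<lambda>w. ((d (a w), d (i w)), Y w)) = distr M borel (\<lambda>w. ((d (a w), d (j w)), Y' w))"
    using atomless_coupling[OF at ai aj Y'm eq, of "\<lambda>(k, l). (d k, d l)"] by auto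
  have snd_m: "(snd :: ('b \<times> 'b) \<times> 'b \<Rightarrow> 'b) \<in> borel_measurable borel"
    and sndfst_m: "(\<lambda>z. snd (fst z) :: 'b) \<in> borel_measurable (borel :: (('b \<times> 'b) \<times> 'b) measure)"
    by (intro borel_measurable_continuous_onI continuous_intros)+
  have Zm: "(\<lambda>w. ((d (a w), d (i w)), Y w)) \<in> borel_measurable M"
      "(\<lambda>w. ((d (a w), d (j w)), Y' w)) \<in> borel_measurable M" by measurable
  have Ylaw: "distr M borel Y = distr M borel Y'"
    using distr_compose_eq[OF YY Zm snd_m] by simp
  have Ysq: "Y \<in> sq_integrable M"
    using distr_eq_sq_integrable(1)[OF Ylaw Y Y'm measurable_ident] Y'sq by simp
  have dlaw: "distr M borel (\<lambda>w. d (i w)) = distr M borel (\<lambda>w. d (j w))"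
    using distr_compose_eq[OF YY Zm sndfst_m] by simp
  have djn: "AE w in M. norm (D w - d (j w)) \<le> e"
    using lDd by (auto simp: j_def dist_norm norm_minus_commute intro!: less_imp_le)
  note dj = sq_integrable_near[OF D _ djn]
  have djsq: "(\<lambda>w. d (j w)) \<in> sq_integrable M" "sq_norm M (\<lambda>w. D w - d (j w)) \<le> e"
    "sq_norm M (\<lambda>w. d (j w)) \<le> N + e" unfolding N_def by (rule dj; simp)+
  have disq: "(\<lambda>w. d (i w)) \<in> sq_integrable M" "sq_norm M (\<lambda>w. d (i w)) \<le> N + e"
    using distr_eq_sq_integrable[OF dlaw dm[OF i] dm[OF j] measurable_ident] djsq by auto
  define K where "K w = Y w - X w" for w
  have K: "K \<in> sq_integrable M" unfolding K_def by (rule sq_integrable_diff[OF Ysq X])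
  note tdi = sq_integrable_scaleR[OF disq(1), of t]
  \<comment> \<open>\<open>2 * (t * e)\<close> is read off the joint law; one more
    \<open>t * e\<close> pays for replacing \<open>d (a w)\<close> by \<open>X w\<close>.\<close>
  have near: "AE w in M. norm (K w - t *\<^sub>R d (i w)) \<le> 3 * (t * e)"
  proof -
    let ?P = "\<lambda>z. norm (snd z - fst (fst z) - t *\<^sub>R snd (fst z)) \<le> 2 * (t * e)"
    have "norm (Y' w - d (a w) - t *\<^sub>R d (j w)) \<le> 2 * (t * e)" for w
    proof -
      have "Y' w - d (a w) - t *\<^sub>R d (j w) = (X w - d (a w)) + t *\<^sub>R (D w - d (j w))"
        by (simp add: Y'_def algebra_simps)
      also have "norm \<dots> \<le> norm (X w - d (a w)) + t * norm (D w - d (j w))"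
        using norm_triangle_ineq[of "X w - d (a w)" "t *\<^sub>R (D w - d (j w))"] t by simp
      also have "\<dots> \<le> t * e + t * e"
        using lXd[of "X w"] lDd[of "D w"] t
        by (intro add_mono mult_left_mono) (auto simp: a_def j_def dist_norm norm_minus_commute)
      finally show ?thesis by (simp add: mult.commute)
    qed
    moreover have Pm: "{z \<in> space borel. ?P z} \<in> sets borel"
      by (simp, intro borel_closed closed_Collect_le continuous_intros)
    ultimately have "AE z in distr M borel (\<lambda>w. ((d (a w), d (j w)), Y' w)). ?P z"
      by (subst AE_distr_iff[OF Zm(2)]) auto
    then have "AE z in distr M borel (\<lambda>w. ((d (a w), d (i w)), Y w)). ?P z" unfolding YY .
    then have "AE w in M. norm (Y w - d (a w) - t *\<^sub>R d (i w)) \<le> 2 * (t * e)"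
      by (subst (asm) AE_distr_iff[OF Zm(1) Pm]) simp
    then show ?thesis
    proof eventually_elim
      case (elim w)
      have "K w - t *\<^sub>R d (i w) = (Y w - d (a w) - t *\<^sub>R d (i w)) + (d (a w) - X w)" by (simp add: K_def)
      then have "norm (K w - t *\<^sub>R d (i w)) \<le> norm (Y w - d (a w) - t *\<^sub>R d (i w)) + norm (d (a w) - X w)"
        using norm_triangle_ineq by metis
      then show ?case using elim lXd[of "X w"] by (simp add: a_def dist_norm)
    qed
  qed
  have Kdi: "(\<lambda>w. K w - t *\<^sub>R d (i w)) \<in> sq_integrable M" "sq_norm M (\<lambda>w. K w - t *\<^sub>R d (i w)) \<le> 3 * (t * e)"
    using sq_integrable_diff[OF K tdi] sq_integrable_near(2)[OF K _ near] by auto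
  have Kn: "sq_norm M K \<le> t * (N + 4)"
  proof -
    have "sq_norm M K \<le> t * sq_norm M (\<lambda>w. d (i w)) + 3 * (t * e)"
      using sq_norm_le_add_diff[OF K tdi] Kdi(2) t by (simp add: sq_norm_scaleR)
    also have "\<dots> \<le> t * (N + e) + 3 * (t * e)" using disq t by simp
    also have "\<dots> \<le> t * (N + 4)" using t e by (simp add: algebra_simps)
    finally show ?thesis .
  qed
  have tN: "t * N < r" "t * (N + 4) < r" using t by (auto simp: algebra_simps)
  have FY: "F (\<lambda>w. X w + K w) = F (\<lambda>w. X w + t *\<^sub>R D w)"
  proof -
    have "F Y = F Y'" using law Ysq Y'sq Ylaw unfolding law_invariant_def by blast
    then show ?thesis by (simp add: K_def Y'_def[abs_def])
  qed
  \<comment> \<open>Facts 1 and 2 expand \<open>F\<close> at the same point along \<open>t D\<close>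
    and along \<open>K\<close>, where its values agree; fact 3 replaces \<open>K\<close> by
    \<open>t *\<^sub>R d (i w)\<close>. The errors add up to
    \<open>t * e * (N + (N + 4) + 3 * N)\<close>.\<close>
  have 1: "\<bar>F (\<lambda>w. X w + t *\<^sub>R D w) - F X - t * N\<^sup>2\<bar> \<le> e * (t * N)"
    using r(2)[OF sq_integrable_scaleR[OF D, of t]] tN t
    by (simp add: sq_norm_scaleR N_def sq_norm_power2 power2_norm_eq_inner)
  have 2: "\<bar>F (\<lambda>w. X w + K w) - F X - (\<integral>w. D w \<bullet> K w \<partial>M)\<bar> \<le> e * (t * (N + 4))"
    using order_trans[OF r(2)[OF K] mult_left_mono[OF Kn, of e]] Kn tN e by simp
  have 3: "\<bar>(\<integral>w. D w \<bullet> K w \<partial>M) - t * (\<integral>w. D w \<bullet> d (i w) \<partial>M)\<bar> \<le> N * (3 * (t * e))"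
    using order_trans[OF sq_norm_cauchy_schwarz[OF D Kdi(1)] mult_left_mono[OF Kdi(2) sq_norm_nonneg]]
      integral_inner_diff[OF D K tdi] by (simp add: N_def)
  define I where "I = (\<integral>w. D w \<bullet> d (i w) \<partial>M)"
  have "t * (N\<^sup>2 - I) \<le> t * (e * (5 * N + 4))"
    using 1 2 3 FY unfolding I_def[symmetric] by (simp add: algebra_simps abs_le_iff)
  then have NI: "N\<^sup>2 - I \<le> e * (5 * N + 4)" using t by simp
  \<comment> \<open>The norm of the copy exceeds \<open>N\<close> by at most \<open>e\<close>, so a
    large inner product \<open>I\<close> forces closeness. The constants are
    \<open>12 * N + 9 = 2 * (5 * N + 4) + 2 * N + 1\<close>, the last 1 from
    \<open>e * e \<le> e\<close>.\<close>
  have "(sq_norm M (\<lambda>w. D w - d (i w)))\<^sup>2 = N\<^sup>2 - 2 * I + (sq_norm M (\<lambda>w. d (i w)))\<^sup>2"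
    unfolding sq_norm_diff_power2[OF D disq(1)] N_def I_def ..
  also have "\<dots> \<le> N\<^sup>2 - 2 * I + (N + e)\<^sup>2" using disq(2) by (simp add: power_mono)
  also have "\<dots> = 2 * (N\<^sup>2 - I) + 2 * N * e + e * e" by (simp add: power2_eq_square algebra_simps)
  also have "\<dots> \<le> 2 * (e * (5 * N + 4)) + 2 * N * e + e * 1" using NI N e by (intro add_mono mult_left_mono) auto
  also have "\<dots> = e * (12 * N + 9)" by (simp add: algebra_simps)
  finally have Ddi: "sq_norm M (\<lambda>w. D w - d (i w)) \<le> sqrt (e * (12 * N + 9))" by (rule real_le_rsqrt)
  define c where "c = e + sqrt (e * (12 * N + 9))"
  have c: "0 \<le> c" using e N by (simp add: c_def)
  have jisq: "(\<lambda>w. d (j w) - d (i w)) \<in> sq_integrable M" by (rule sq_integrable_diff[OF djsq(1) disq(1)])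
  have ji: "sq_norm M (\<lambda>w. d (j w) - d (i w)) \<le> c"
    using sq_norm_triangle[OF sq_integrable_diff[OF djsq(1) D] sq_integrable_diff[OF D disq(1)]]
      djsq(2) Ddi sq_norm_minus_commute[of M D "\<lambda>w. d (j w)"] by (simp add: c_def)
  \<comment> \<open>With the squared distance of representatives as cost, \<open>i\<close> is
    replaced by a function of \<open>a\<close>, hence of \<open>X\<close>, without moving further
    from \<open>d (j w)\<close>.\<close>
  obtain \<iota> where \<iota>: "(\<integral>\<^sup>+w. ennreal ((norm (d (j w) - d (\<iota> (a w))))\<^sup>2) \<partial>M) \<le>
      (\<integral>\<^sup>+w. ennreal ((norm (d (j w) - d (i w)))\<^sup>2) \<partial>M)"
    using opt[of "\<lambda>l m. ennreal ((norm (d l - d m))\<^sup>2)"] by blast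
  define h where "h x = d (\<iota> (lX x))" for x
  have h[measurable]: "h \<in> borel_measurable borel"
    unfolding h_def by (rule measurable_compose[OF lX]) simp
  have ha: "h (X w) = d (\<iota> (a w))" for w by (simp add: h_def a_def)
  have "(\<integral>\<^sup>+w. ennreal ((norm (d (j w) - h (X w)))\<^sup>2) \<partial>M) \<le> ennreal (c\<^sup>2)"
    using \<iota> ji unfolding nn_integral_sq_norm[OF jisq] ha
    by (rule order_trans[OF _ ennreal_leI[OF power_mono]]) simp
  then have jh: "(\<lambda>w. d (j w) - h (X w)) \<in> sq_integrable M" "sq_norm M (\<lambda>w. d (j w) - h (X w)) \<le> c"
    using c by (intro sq_norm_leI[where c=c]; simp)+
  have hsq: "(\<lambda>w. h (X w)) \<in> sq_integrable M"
    using sq_integrable_diff[OF djsq(1) jh(1)] by simp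
  have "sq_norm M (\<lambda>w. D w - h (X w)) \<le> e + c"
    using sq_norm_triangle[OF sq_integrable_diff[OF D djsq(1)] jh(1)] djsq(2) jh(2) by simp
  then show ?thesis using h hsq by (intro bexI[of _ h]) (auto simp: c_def N_def)
qed

text \<open>A subsequence of the approximations converges almost everywhere. The limit is taken on
  the value space of \<open>X\<close> rather than on the sample space, which makes \<open>g\<close>
  Borel at once.\<close>

lemma (in prob_space) function_of_if_near_functions:
  fixes D :: "'a \<Rightarrow> 'b::euclidean_space" and X :: "'a \<Rightarrow> 'c::euclidean_space"
  assumes D: "D \<in> sq_integrable M" and X[measurable]: "X \<in> borel_measurable M"
    and near: "\<And>e. 0 < e \<Longrightarrow> \<exists>h\<in>borel_measurable borel. (\<lambda>w. h (X w)) \<in> sq_integrable M \<and>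
      sq_norm M (\<lambda>w. D w - h (X w)) \<le> e"
  shows "\<exists>g\<in>borel_measurable borel. AE w in M. D w = g (X w)"
proof -
  have "\<exists>h. \<forall>n::nat. h n \<in> borel_measurable borel \<and> (\<lambda>w. h n (X w)) \<in> sq_integrable M \<and>
      sq_norm M (\<lambda>w. D w - h n (X w)) \<le> (1/2)^n"
    by (intro choice allI) (use near in \<open>auto simp: Bex_def\<close>)
  then obtain h where h[measurable]: "\<And>n::nat. h n \<in> borel_measurable borel"
    and hsq: "\<And>n. (\<lambda>w. h n (X w)) \<in> sq_integrable M"
    and hn: "\<And>n. sq_norm M (\<lambda>w. D w - h n (X w)) \<le> (1/2)^n" by blast
  have int: "integrable M (\<lambda>w. (norm (D w - h n (X w)))\<^sup>2)" for n
    using sq_integrable_diff[OF D hsq] by (rule sq_integrableD)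
  have "(\<lambda>n. \<integral>w. norm ((norm (D w - h n (X w)))\<^sup>2) \<partial>M) \<longlonglongrightarrow> 0"
  proof (rule real_tendsto_sandwich[OF _ _ tendsto_const])
    have "(\<integral>w. norm ((norm (D w - h n (X w)))\<^sup>2) \<partial>M) \<le> ((1/2)^n)\<^sup>2" for n
      using power_mono[OF hn[of n], of 2] by (simp add: sq_norm_power2)
    then show "\<forall>\<^sub>F n in sequentially. (\<integral>w. norm ((norm (D w - h n (X w)))\<^sup>2) \<partial>M) \<le> ((1/2)^n)\<^sup>2" by simp
    have "(\<lambda>n. ((1/2)^n)\<^sup>2 :: real) \<longlonglongrightarrow> 0\<^sup>2" by (intro tendsto_power LIMSEQ_power_zero) simp
    then show "(\<lambda>n. ((1/2)^n)\<^sup>2 :: real) \<longlonglongrightarrow> 0" by simp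
  qed simp
  from tendsto_L1_AE_subseq[OF int this] obtain s where
    s: "AE w in M. (\<lambda>n. (norm (D w - h (s n) (X w)))\<^sup>2) \<longlonglongrightarrow> 0" by blast
  define g where "g x = lim (\<lambda>n. h (s n) x)" for x
  have g: "g \<in> borel_measurable borel"
    unfolding g_def by (rule borel_measurable_lim_metric) measurable
  have "AE w in M. D w = g (X w)"
    using s
  proof eventually_elim
    case (elim w)
    then have "(\<lambda>n. sqrt ((norm (D w - h (s n) (X w)))\<^sup>2)) \<longlonglongrightarrow> sqrt 0" by (rule tendsto_real_sqrt)
    then have "(\<lambda>n. D w - h (s n) (X w)) \<longlonglongrightarrow> 0" by (simp add: tendsto_norm_zero_iff)
    then have "(\<lambda>n. D w - (D w - h (s n) (X w))) \<longlonglongrightarrow> D w - 0" by (intro tendsto_diff tendsto_const)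
    then show ?case unfolding g_def by (simp add: limI)
  qed
  then show ?thesis using g by blast
qed

text \<open>A copy \<open>Y\<close> of \<open>X' + H\<close> that has the same joint law with the fine cell of \<open>(X, g(X))\<close> as
  \<open>X' + H\<close> has with the cell of \<open>(X', g(X'))\<close> reduces the expansion of \<open>F\<close> at \<open>X'\<close> to the one
  at \<open>X\<close>, up to an error that vanishes with the size of the cells.\<close>

lemma (in prob_space) frechet_derivative_transfer:
  fixes F :: "('a \<Rightarrow> 'b::euclidean_space) \<Rightarrow> real"
  assumes at: "atomless M" and law: "law_invariant M F"
    and X: "X \<in> sq_integrable M" and X': "X' \<in> sq_integrable M"
    and XX': "distr M borel X = distr M borel X'"
    and g[measurable]: "g \<in> borel_measurable borel"
    and FX: "has_frechet_derivative_at M F X (\<lambda>w. g (X w))"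
  shows "has_frechet_derivative_at M F X' (\<lambda>w. g (X' w))"
proof -
  have [measurable]: "X \<in> borel_measurable M" "X' \<in> borel_measurable M"
    using X X' by (auto dest: sq_integrableD)
  have gX: "(\<lambda>w. g (X w)) \<in> sq_integrable M" using FX by (simp add: has_frechet_derivative_at_iff)
  have gX': "(\<lambda>w. g (X' w)) \<in> sq_integrable M"
    using distr_eq_sq_integrable(1)[OF XX' _ _ g] gX by simp
  define N where "N = sq_norm M (\<lambda>w. g (X w))"
  have N': "sq_norm M (\<lambda>w. g (X' w)) = N"
    unfolding N_def using distr_eq_sq_integrable(2)[OF XX' _ _ g] by simp
  have FXX': "F X' = F X" using law X X' XX' unfolding law_invariant_def by metis
  obtain d :: "nat \<Rightarrow> 'b \<times> 'b" where d:
    "\<forall>e>0. \<exists>l\<in>measurable borel (count_space UNIV). \<forall>y. dist (d (l y)) y < e"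
    using ex_countable_quantization by blast
  have approx: "\<exists>K\<in>sq_integrable M. sq_norm M K \<le> sq_norm M H + 2 * \<delta> \<and>
      F (\<lambda>w. X' w + H w) = F (\<lambda>w. X w + K w) \<and>
      \<bar>(\<integral>w. g (X w) \<bullet> K w \<partial>M) - (\<integral>w. g (X' w) \<bullet> H w \<partial>M)\<bar> \<le> 2 * \<delta> * (sq_norm M H + N + 3 * \<delta>)"
    if H: "H \<in> sq_integrable M" and \<delta>: "0 < \<delta>" for H \<delta>
  proof -
    have [measurable]: "H \<in> borel_measurable M" using H by (rule sq_integrableD)
    obtain l where l[measurable]: "l \<in> measurable borel (count_space UNIV)"
      and ld: "\<And>y. dist (d (l y)) y < \<delta>" using d \<delta> by blast
    \<comment> \<open>The pair is quantized because \<open>g\<close> is merely measurable: nearby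
      \<open>x\<close> need not have nearby \<open>g x\<close>.\<close>
    define c where "c x = l (x, g x)" for x
    have c[measurable]: "c \<in> measurable borel (count_space UNIV)" unfolding c_def by measurable
    have cX: "(\<lambda>w. c (X w)) \<in> measurable M (count_space UNIV)"
      "(\<lambda>w. c (X' w)) \<in> measurable M (count_space UNIV)" by measurable
    have clX: "distr M (count_space UNIV) (\<lambda>w. c (X w)) = distr M (count_space UNIV) (\<lambda>w. c (X' w))"
      using distr_compose_eq[OF XX' _ _ c] by simp
    define Y' where "Y' w = X' w + H w" for w
    have Y'sq: "Y' \<in> sq_integrable M" unfolding Y'_def by (rule sq_integrable_add[OF X' H])
    have Y'm: "Y' \<in> borel_measurable M" using Y'sq by (rule sq_integrableD)
    obtain Y where Y: "Y \<in> borel_measurable M"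
      and YY: "distr M borel (\<lambda>w. (d (c (X w)), Y w)) = distr M borel (\<lambda>w. (d (c (X' w)), Y' w))"
      using atomless_coupling[OF at cX Y'm clX] by blast
    define u where "u x = fst (d (c x))" for x
    define v where "v x = snd (d (c x))" for x
    have dc: "(\<lambda>x. d (c x)) \<in> borel_measurable borel"
      by (rule measurable_compose[OF c]) simp
    have [measurable]: "u \<in> borel_measurable borel" "v \<in> borel_measurable borel"
      unfolding u_def v_def by (rule measurable_compose[OF c]; simp)+
    have ux: "norm (u x - x) \<le> \<delta>" and vx: "norm (v x - g x) \<le> \<delta>" for x
      using ld[of "(x, g x)"] dist_fst_le[of "d (c x)" "(x, g x)"] dist_snd_le[of "d (c x)" "(x, g x)"]
      by (auto simp: u_def v_def c_def dist_norm)
    have Zm: "(\<lambda>w. (d (c (X w)), Y w)) \<in> borel_measurable M"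
        "(\<lambda>w. (d (c (X' w)), Y' w)) \<in> borel_measurable M"
      using measurable_compose[OF _ dc, of X M] measurable_compose[OF _ dc, of X' M] Y Y'm
      by (auto intro: borel_measurable_Pair)
    have diff_m: "(\<lambda>z. snd z - fst (fst z)) \<in> borel_measurable (borel :: (('b \<times> 'b) \<times> 'b) measure)"
      and inner_m: "(\<lambda>z. snd (fst z) \<bullet> (snd z - fst (fst z))) \<in> borel_measurable (borel :: (('b \<times> 'b) \<times> 'b) measure)"
      and snd_m: "snd \<in> borel_measurable (borel :: (('b \<times> 'b) \<times> 'b) measure)"
      by (intro borel_measurable_continuous_onI continuous_intros)+
    have Ylaw: "distr M borel Y = distr M borel Y'"
      using distr_compose_eq[OF YY Zm snd_m] by simp
    have Ysq: "Y \<in> sq_integrable M"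
      using distr_eq_sq_integrable(1)[OF Ylaw Y Y'm measurable_ident] Y'sq by simp
    have cells: "(\<lambda>w. u (T w)) \<in> sq_integrable M" "(\<lambda>w. v (T w)) \<in> sq_integrable M"
        "sq_norm M (\<lambda>w. T w - u (T w)) \<le> \<delta>" "sq_norm M (\<lambda>w. g (T w) - v (T w)) \<le> \<delta>"
        "sq_norm M (\<lambda>w. v (T w)) \<le> sq_norm M (\<lambda>w. g (T w)) + \<delta>"
      if T: "T \<in> sq_integrable M" "(\<lambda>w. g (T w)) \<in> sq_integrable M" for T
    proof -
      have [measurable]: "T \<in> borel_measurable M" using T(1) by (rule sq_integrableD)
      have "AE w in M. norm (T w - u (T w)) \<le> \<delta>" "AE w in M. norm (g (T w) - v (T w)) \<le> \<delta>"
        using ux vx by (simp_all add: norm_minus_commute)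
      note * = sq_integrable_near[OF T(1) _ this(1)] sq_integrable_near[OF T(2) _ this(2)]
      show "(\<lambda>w. u (T w)) \<in> sq_integrable M" "(\<lambda>w. v (T w)) \<in> sq_integrable M"
        "sq_norm M (\<lambda>w. T w - u (T w)) \<le> \<delta>" "sq_norm M (\<lambda>w. g (T w) - v (T w)) \<le> \<delta>"
        "sq_norm M (\<lambda>w. v (T w)) \<le> sq_norm M (\<lambda>w. g (T w)) + \<delta>"
        by (rule *; measurable)+
    qed
    note cellX = cells[OF X gX] and cellX' = cells[OF X' gX']
    define n where "n = sq_norm M (\<lambda>w. Y w - u (X w))"
    have n': "n = sq_norm M (\<lambda>w. Y' w - u (X' w))"
      unfolding n_def using distr_eq_sq_integrable(2)[OF YY Zm diff_m] by (simp add: u_def)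
    have same: "(\<integral>w. v (X w) \<bullet> (Y w - u (X w)) \<partial>M) = (\<integral>w. v (X' w) \<bullet> (Y' w - u (X' w)) \<partial>M)"
      using distr_eq_integral[OF YY Zm inner_m] by (simp add: u_def v_def)
    \<comment> \<open>The expectation with \<open>v\<close> and \<open>u\<close> depends only on the
      joint law of cell and \<open>W\<close>, hence agrees for \<open>X\<close> and
      \<open>X'\<close>. Passing from \<open>g\<close> to \<open>v\<close> costs the first error
      term, from \<open>T\<close> to its cell point the second.\<close>
    have comp: "\<bar>(\<integral>w. g (T w) \<bullet> (W w - T w) \<partial>M) - (\<integral>w. v (T w) \<bullet> (W w - u (T w)) \<partial>M)\<bar> \<le>
        \<delta> * sq_norm M (\<lambda>w. W w - T w) + (N + \<delta>) * \<delta>"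
      if T: "T \<in> sq_integrable M" "(\<lambda>w. g (T w)) \<in> sq_integrable M" and gT: "sq_norm M (\<lambda>w. g (T w)) = N"
        and W: "W \<in> sq_integrable M" for T W
    proof -
      note cT = cells[OF T]
      note WT = sq_integrable_diff[OF W T(1)] and gv = sq_integrable_diff[OF T(2) cT(2)]
        and Tu = sq_integrable_diff[OF T(1) cT(1)] and Wu = sq_integrable_diff[OF W cT(1)]
      have "(\<integral>w. (g (T w) - v (T w)) \<bullet> (W w - T w) \<partial>M) =
          (\<integral>w. g (T w) \<bullet> (W w - T w) \<partial>M) - (\<integral>w. v (T w) \<bullet> (W w - T w) \<partial>M)"
        using integrable_inner_sq_integrable[OF T(2) WT] integrable_inner_sq_integrable[OF cT(2) WT]
        by (simp add: inner_diff_left)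
      moreover have "(\<integral>w. v (T w) \<bullet> (W w - u (T w)) \<partial>M) =
          (\<integral>w. v (T w) \<bullet> (W w - T w) \<partial>M) + (\<integral>w. v (T w) \<bullet> (T w - u (T w)) \<partial>M)"
        using integral_inner_add[OF cT(2) WT Tu] by simp
      moreover have "\<bar>\<integral>w. (g (T w) - v (T w)) \<bullet> (W w - T w) \<partial>M\<bar> \<le> \<delta> * sq_norm M (\<lambda>w. W w - T w)"
        using sq_norm_cauchy_schwarz[OF gv WT] mult_right_mono[OF cT(4) sq_norm_nonneg] by (rule order_trans)
      moreover have "\<bar>\<integral>w. v (T w) \<bullet> (T w - u (T w)) \<partial>M\<bar> \<le> (N + \<delta>) * \<delta>"
        using sq_norm_cauchy_schwarz[OF cT(2) Tu] mult_mono[OF cT(5) cT(3)] gT N'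
        by (smt (verit) sq_norm_nonneg \<delta>)
      ultimately show ?thesis by linarith
    qed
    define K where "K w = Y w - X w" for w
    have K: "K \<in> sq_integrable M" unfolding K_def by (rule sq_integrable_diff[OF Ysq X])
    have H_eq: "Y' w - X' w = H w" for w by (simp add: Y'_def)
    have "n \<le> sq_norm M H + \<delta>"
      using sq_norm_triangle[OF H sq_integrable_diff[OF X' cellX'(1)]] cellX'(3)
      unfolding n' by (simp add: Y'_def algebra_simps)
    moreover have "sq_norm M K \<le> n + \<delta>"
      using sq_norm_triangle[OF sq_integrable_diff[OF Ysq cellX(1)] sq_integrable_diff[OF cellX(1) X]] cellX(3)
      unfolding n_def K_def by (simp add: sq_norm_minus_commute[of M X])
    ultimately have Kn: "sq_norm M K \<le> sq_norm M H + 2 * \<delta>" by simp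
    moreover have "F (\<lambda>w. X' w + H w) = F (\<lambda>w. X w + K w)"
    proof -
      have "F Y = F Y'" using law Ysq Y'sq Ylaw unfolding law_invariant_def by blast
      then show ?thesis by (simp add: K_def Y'_def[abs_def])
    qed
    moreover have "\<bar>(\<integral>w. g (X w) \<bullet> K w \<partial>M) - (\<integral>w. g (X' w) \<bullet> H w \<partial>M)\<bar> \<le> 2 * \<delta> * (sq_norm M H + N + 3 * \<delta>)"
    proof -
      have "\<bar>(\<integral>w. g (X w) \<bullet> K w \<partial>M) - (\<integral>w. g (X' w) \<bullet> H w \<partial>M)\<bar> \<le>
          (\<delta> * sq_norm M K + (N + \<delta>) * \<delta>) + (\<delta> * sq_norm M H + (N + \<delta>) * \<delta>)"
        using comp[OF X gX _ Ysq] comp[OF X' gX' N' Y'sq] same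
        unfolding H_eq K_def[symmetric] N_def by linarith
      also have "\<dots> \<le> (\<delta> * (sq_norm M H + 2 * \<delta>) + (N + \<delta>) * \<delta>) + (\<delta> * sq_norm M H + (N + \<delta>) * \<delta>)"
        using Kn \<delta> by (intro add_mono mult_left_mono order_refl) auto
      also have "\<dots> \<le> 2 * \<delta> * (sq_norm M H + N + 3 * \<delta>)"
        using \<delta> by (simp add: algebra_simps)
      finally show ?thesis .
    qed
    ultimately show ?thesis using K by blast
  qed
  have "\<exists>r>0. \<forall>H\<in>sq_integrable M. sq_norm M H < r \<longrightarrow>
      \<bar>F (\<lambda>w. X' w + H w) - F X' - (\<integral>w. g (X' w) \<bullet> H w \<partial>M)\<bar> \<le> e * sq_norm M H" if e: "0 < e" for e
  proof -
    obtain r where r: "0 < r" "\<And>K. K \<in> sq_integrable M \<Longrightarrow> sq_norm M K < r \<Longrightarrow>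
        \<bar>F (\<lambda>w. X w + K w) - F X - (\<integral>w. g (X w) \<bullet> K w \<partial>M)\<bar> \<le> e * sq_norm M K"
      using FX e unfolding has_frechet_derivative_at_iff by meson
    have "\<bar>F (\<lambda>w. X' w + H w) - F X' - (\<integral>w. g (X' w) \<bullet> H w \<partial>M)\<bar> \<le> e * sq_norm M H"
      if H: "H \<in> sq_integrable M" and Hr: "sq_norm M H < r" for H
    \<comment> \<open>\<open>H\<close> stays fixed while the cell size \<open>\<delta>\<close> tends
      to 0, so the \<open>e\<close> and \<open>r\<close> of \<open>X\<close> serve unchanged for
      \<open>X'\<close>. The strict bound on the norm of \<open>H\<close> leaves room for
      \<open>2 * \<delta>\<close>.\<close>
    proof (rule tendsto_lowerbound[where F="at_right (0::real)"])
      let ?f = "\<lambda>\<delta>. e * (sq_norm M H + 2 * \<delta>) + 2 * \<delta> * (sq_norm M H + N + 3 * \<delta>)"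
      have "(?f \<longlongrightarrow> ?f 0) (at_right 0)" by (intro tendsto_intros)
      then show "(?f \<longlongrightarrow> e * sq_norm M H) (at_right 0)" by simp
      have "\<forall>\<^sub>F \<delta> in at_right 0. \<delta> \<in> {0<..<(r - sq_norm M H) / 2}"
        using Hr by (intro eventually_at_rightI[where b="(r - sq_norm M H) / 2"]) auto
      then show "\<forall>\<^sub>F \<delta> in at_right 0. \<bar>F (\<lambda>w. X' w + H w) - F X' - (\<integral>w. g (X' w) \<bullet> H w \<partial>M)\<bar> \<le> ?f \<delta>"
      proof eventually_elim
        case (elim \<delta>)
        then have \<delta>: "0 < \<delta>" "sq_norm M H + 2 * \<delta> < r" by auto
        obtain K where K: "K \<in> sq_integrable M" "sq_norm M K \<le> sq_norm M H + 2 * \<delta>"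
          "F (\<lambda>w. X' w + H w) = F (\<lambda>w. X w + K w)"
          "\<bar>(\<integral>w. g (X w) \<bullet> K w \<partial>M) - (\<integral>w. g (X' w) \<bullet> H w \<partial>M)\<bar> \<le> 2 * \<delta> * (sq_norm M H + N + 3 * \<delta>)"
          using approx[OF H \<delta>(1)] by blast
        have "\<bar>F (\<lambda>w. X w + K w) - F X - (\<integral>w. g (X w) \<bullet> K w \<partial>M)\<bar> \<le> e * (sq_norm M H + 2 * \<delta>)"
          using order_trans[OF r(2)[OF K(1)] mult_left_mono[OF K(2), of e]] K(2) \<delta> e by simp
        then show ?case using K(3,4) FXX' by linarith
      qed
    qed simp
    then show ?thesis using r(1) by blast
  qed
  then show ?thesis using gX' by (simp add: has_frechet_derivative_at_iff)
qed

theorem lemma2p4: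
  fixes P :: "'w measure"
    and F :: "('w \<Rightarrow> real ^ 'd) \<Rightarrow> real"
    and X :: "'w \<Rightarrow> real ^ 'd"
    and \<mu> :: "(real ^ 'd) measure"
  assumes "prob_space P"
    and "atomless P"
    and "law_invariant P F"
    and "X \<in> sq_integrable P"
    and "distr P borel X = \<mu>"
    and "frechet_differentiable_at P F X"
  shows "\<exists>g :: real ^ 'd \<Rightarrow> real ^ 'd.
           g \<in> borel_measurable borel \<and> g \<in> sq_integrable \<mu> \<and>
           has_frechet_derivative_at P F X (\<lambda>w. g (X w)) \<and>
           (\<forall>D. has_frechet_derivative_at P F X D \<longrightarrow> (AE w in P. D w = g (X w))) \<and>
           (\<forall>X'\<in>sq_integrable P. distr P borel X' = \<mu> \<longrightarrow>
              has_frechet_derivative_at P F X' (\<lambda>w. g (X' w)))"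
proof -
  interpret prob_space P by fact
  have Xm[measurable]: "X \<in> borel_measurable P" using assms(4) by (rule sq_integrableD)
  obtain D where FD: "has_frechet_derivative_at P F X D"
    using ex_frechet_derivative[OF assms(6)] by blast
  then have D: "D \<in> sq_integrable P" by (simp add: has_frechet_derivative_at_iff)
  define C where "C = 12 * sq_norm P D + 9"
  have "\<exists>h\<in>borel_measurable borel. (\<lambda>w. h (X w)) \<in> sq_integrable P \<and>
      sq_norm P (\<lambda>w. D w - h (X w)) \<le> \<epsilon>" if "0 < \<epsilon>" for \<epsilon>
  proof -
    \<comment> \<open>The approximation error vanishes with \<open>e\<close>, so any accuracy is
      reached by some \<open>e\<close> below 1.\<close>
    have "((\<lambda>e. 2 * e + sqrt (e * C)) \<longlongrightarrow> 2 * 0 + sqrt (0 * C)) (at_right 0)"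
      by (intro tendsto_intros)
    then have "\<forall>\<^sub>F e in at_right 0. 2 * e + sqrt (e * C) < \<epsilon>"
      using \<open>0 < \<epsilon>\<close> by (intro order_tendstoD(2)[where y="2 * 0 + sqrt (0 * C)"]) auto
    moreover have "\<forall>\<^sub>F e in at_right 0. e \<in> {0<..<1::real}"
      by (intro eventually_at_rightI[where b=1]) auto
    ultimately have "\<forall>\<^sub>F e in at_right 0. 2 * e + sqrt (e * C) < \<epsilon> \<and> e \<in> {0<..<1}"
      by (rule eventually_conj)
    then obtain e where "2 * e + sqrt (e * C) < \<epsilon>" "0 < e" "e \<le> 1"
      using eventually_happens'[of "at_right (0::real)"] by force
    then show ?thesis
      using frechet_derivative_near_function[OF assms(2,3,4) FD, of e] unfolding C_def by force
  qed
  then obtain g where g[measurable]: "g \<in> borel_measurable borel" and Dg: "AE w in P. D w = g (X w)"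
    using function_of_if_near_functions[OF D Xm] by blast
  \<comment> \<open>\<open>D\<close> and \<open>g (X w)\<close> agree only almost everywhere; the
    integrals in the expansion do not see the difference.\<close>
  have int: "(\<integral>w. D w \<bullet> H w \<partial>P) = (\<integral>w. g (X w) \<bullet> H w \<partial>P)" if "H \<in> sq_integrable P" for H
    using that D Dg by (intro integral_cong_AE) (auto simp: sq_integrable_def)
  have gX: "(\<lambda>w. g (X w)) \<in> sq_integrable P"
    by (rule sq_integrable_near(1)[OF D, where c=0]) (use Dg in auto)
  have FX: "has_frechet_derivative_at P F X (\<lambda>w. g (X w))"
    using FD gX int by (simp add: has_frechet_derivative_at_iff)
  have "g \<in> sq_integrable \<mu>"
    using gX unfolding assms(5)[symmetric] by (simp add: sq_integrable_def integrable_distr_eq)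
  then show ?thesis
    using g FX frechet_derivative_unique[OF _ FX] frechet_derivative_transfer[OF assms(2-4) _ _ g FX] assms(5)
    by (intro exI[of _ g]) auto
qed

end
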